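(* There is an absolute constant $C>0$ such that the following holds. Let $N=2^n$, $M=2^{n-r}$ with $0\le r\le n$, let $H$ be a Hermitian operator on $\mathbb{C}^N$, let $\{P_i\}_{i=1}^M$ be mutually orthogonal projectors of rank $2^r$ each with $\sum_i P_i=\mathbb{I}_N$, and let $\rho$ be a density matrix on $\mathbb{C}^N$ of which independent copies are available. Let $U_{\mathrm{gl}}$ be a global unitary as in the definition of the observational ergotropy $\mathrm{Erg}_{\mathrm{obs}}(\rho)$. For every $\varepsilon>0$ and $\delta\in(0,1)$, and every integer $T\ge 1$ with $$T\ge C\,\frac{\|H\|^2\log(2/\delta)}{\varepsilon^2},$$ the output $\mu$ of the work-extraction protocol (defined in the context) run with $T$ iterations, each consuming one fresh copy of $\rho$, satisfies $$|\mu-\mathrm{Erg}_{\mathrm{obs}}(\rho)|\le\varepsilon$$ with probability at least $1-\delta$.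
   Context: Definitions. Put $p_i=\mathrm{Tr}[P_i\rho]$ and $\widetilde\rho=\sum_{i=1}^M p_iP_i/2^r$ (the coarse-grained state). The observational ergotropy of $\rho$ with respect to $H$ and $\{P_i\}$ is $$\mathrm{Erg}_{\mathrm{obs}}(\rho)=\mathrm{Tr}[H\rho]-\min_{U\in\mathsf{U}(N)}\mathrm{Tr}[HU\widetilde\rho U^\dagger]=\mathrm{Tr}\big[H(\rho-U_{\mathrm{gl}}\widetilde\rho U_{\mathrm{gl}}^\dagger)\big],$$ where $U_{\mathrm{gl}}$ is a unitary mapping an orthonormal basis adapted to the ranges of the $P_i$, with the blocks taken in non-increasing order of $p_i$, to an orthonormal eigenbasis of $H$ listed in non-decreasing order of energy. $\|H\|$ is the spectral norm. Identify $\mathbb{C}^N$ with $\mathbb{C}^M\otimes(\mathbb{C}^2)^{\otimes r}$ so that $P_i=|i\rangle\langle i|\otimes\mathbb{I}_{2^r}$. The $r$-qubit Pauli group is the group of the $4^{r+1}$ unitaries $i^k\sigma_1\otimes\cdots\otimes\sigma_r$ with $k\in\{0,1,2,3\}$ and each $\sigma_j\in\{\mathbb{I}_2,X,Y,Z\}$. "Measuring" a Hermitian observable $O$ on a state $\sigma$ returns an eigenvalue $\lambda$ of $O$ with probability $\mathrm{Tr}[\sigma\Pi_\lambda]$, $\Pi_\lambda$ being the corresponding eigenprojector. Work-extraction protocol. In each of $T$ independent iterations $j=1,\dots,T$, on a fresh copy of $\rho$: (1) with probability $1/2$, measure $H$ on $\rho$ and let $\mu_j$ be the outcome; (2) with probability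 $1/2$: (a) perform the projective measurement $\{P_i\}$ on $\rho$ and ignore the outcome, obtaining the post-measurement state $\bar\rho$; (b) sample $U_r$ uniformly at random from the $r$-qubit Pauli group and apply $U_{\mathrm{gl}}(\mathbb{I}_M\otimes U_r)$ to $\bar\rho$, obtaining $\rho'=U_{\mathrm{gl}}(\mathbb{I}_M\otimes U_r)\bar\rho(\mathbb{I}_M\otimes U_r)^\dagger U_{\mathrm{gl}}^\dagger$; (c) measure $-H$ on $\rho'$ and let $\mu_j$ be the outcome. The output is $\mu=\frac{2}{T}\sum_{j=1}^T\mu_j$. *)

theory Defs
  imports
    "HOL-Probability.Product_PMF"
    "Jordan_Normal_Form.Schur_Decomposition"
    "Jordan_Normal_Form.DL_Rank"
begin

subsection \<open>Operators on a finite-dimensional Hilbert space\<close>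

text \<open>Operators on \<open>\<complex>\<^sup>N\<close> are complex \<open>N \<times> N\<close> matrices; the indices of
  matrix entries, basis vectors and projectors start at 0.
  Traces that are real for mathematical reasons are turned into reals by \<^const>\<open>Re\<close>.\<close>

definition mat_trace :: "complex mat \<Rightarrow> complex" where
  "mat_trace A = (\<Sum>i<dim_row A. A $$ (i, i))"

definition mat_sum :: "nat \<Rightarrow> (nat \<Rightarrow> complex mat) \<Rightarrow> nat set \<Rightarrow> complex mat" where
  "mat_sum N A I = Matrix.mat N N (\<lambda>(a, b). \<Sum>i\<in>I. A i $$ (a, b))"

definition hermitian_op :: "nat \<Rightarrow> complex mat \<Rightarrow> bool" where
  "hermitian_op N A \<longleftrightarrow> A \<in> carrier_mat N N \<and> mat_adjoint A = A"

definition unitary_op :: "nat \<Rightarrow> complex mat \<Rightarrow> bool" where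
  "unitary_op N U \<longleftrightarrow>
     U \<in> carrier_mat N N \<and> mat_adjoint U * U = 1\<^sub>m N \<and> U * mat_adjoint U = 1\<^sub>m N"

definition projector :: "nat \<Rightarrow> complex mat \<Rightarrow> bool" where
  "projector N P \<longleftrightarrow> hermitian_op N P \<and> P * P = P"

definition density_op :: "nat \<Rightarrow> complex mat \<Rightarrow> bool" where
  "density_op N \<rho> \<longleftrightarrow> hermitian_op N \<rho> \<and>
     (\<forall>v\<in>carrier_vec N. 0 \<le> Re ((\<rho> *\<^sub>v v) \<bullet>c v)) \<and> mat_trace \<rho> = 1"

definition op_range :: "complex mat \<Rightarrow> complex Matrix.vec set" where
  "op_range A = {A *\<^sub>v x | x. x \<in> carrier_vec (dim_col A)}"

definition orthonormal_basis :: "nat \<Rightarrow> (nat \<Rightarrow> complex Matrix.vec) \<Rightarrow> bool" where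
  "orthonormal_basis N e \<longleftrightarrow> (\<forall>k<N. e k \<in> carrier_vec N) \<and>
     (\<forall>k<N. \<forall>l<N. e k \<bullet>c e l = (if k = l then 1 else 0))"

definition euclid_norm :: "complex Matrix.vec \<Rightarrow> real" where
  "euclid_norm v = sqrt (Re (v \<bullet>c v))"

definition spectral_norm :: "complex mat \<Rightarrow> real" where
  "spectral_norm A =
     Sup {euclid_norm (A *\<^sub>v v) | v. v \<in> carrier_vec (dim_col A) \<and> euclid_norm v = 1}"

definition kron :: "complex mat \<Rightarrow> complex mat \<Rightarrow> complex mat" where
  "kron A B = Matrix.mat (dim_row A * dim_row B) (dim_col A * dim_col B)
     (\<lambda>(i, j). A $$ (i div dim_row B, j div dim_col B) * B $$ (i mod dim_row B, j mod dim_col B))"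

text \<open>The rank-one operator \<open>|i\<rangle>\<langle>i|\<close> on \<open>\<complex>\<^sup>M\<close>.\<close>

definition basis_projector :: "nat \<Rightarrow> nat \<Rightarrow> complex mat" where
  "basis_projector M i = Matrix.mat M M (\<lambda>(a, b). if a = i \<and> b = i then 1 else 0)"

subsection \<open>The Pauli group\<close>

definition pauli_X :: "complex mat" where
  "pauli_X = mat_of_rows_list 2 [[0, 1], [1, 0]]"

definition pauli_Y :: "complex mat" where
  "pauli_Y = mat_of_rows_list 2 [[0, - \<i>], [\<i>, 0]]"

definition pauli_Z :: "complex mat" where
  "pauli_Z = mat_of_rows_list 2 [[1, 0], [0, - 1]]"

definition pauli_group :: "nat \<Rightarrow> complex mat set" where
  "pauli_group r = {\<i> ^ k \<cdot>\<^sub>m foldr kron \<sigma>s (1\<^sub>m 1) | k \<sigma>s.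
     k < 4 \<and> length \<sigma>s = r \<and> set \<sigma>s \<subseteq> {1\<^sub>m 2, pauli_X, pauli_Y, pauli_Z}}"

subsection \<open>Measuring an observable\<close>

text \<open>The orthogonal projector onto \<open>{v. O v = \<lambda> v}\<close>; it is the zero matrix if \<open>\<lambda>\<close> is not an
  eigenvalue, so the outcome distribution below is supported on the spectrum. For Hermitian \<open>O\<close> and
  a density matrix \<open>\<sigma>\<close> the weights are non-negative and sum to 1 by the spectral theorem, so
  \<^const>\<open>embed_pmf\<close> returns the distribution with exactly these weights.\<close>

definition eigenprojector :: "complex mat \<Rightarrow> real \<Rightarrow> complex mat" where
  "eigenprojector A l = (THE Q. projector (dim_row A) Q \<and>
     op_range Q = {v \<in> carrier_vec (dim_row A). A *\<^sub>v v = complex_of_real l \<cdot>\<^sub>v v})"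

definition measure_observable :: "complex mat \<Rightarrow> complex mat \<Rightarrow> real pmf" where
  "measure_observable A \<sigma> = embed_pmf (\<lambda>l. Re (mat_trace (\<sigma> * eigenprojector A l)))"

subsection \<open>Observational ergotropy\<close>

text \<open>A complete family \<open>P 0, \<dots>, P (M - 1)\<close> of mutually orthogonal projectors of rank \<open>2\<^sup>r\<close>.\<close>

definition projective_measurement ::
    "nat \<Rightarrow> nat \<Rightarrow> nat \<Rightarrow> (nat \<Rightarrow> complex mat) \<Rightarrow> bool" where
  "projective_measurement N M r P \<longleftrightarrow>
     (\<forall>i<M. projector N (P i) \<and> vec_space.rank N (P i) = 2 ^ r) \<and>
     (\<forall>i<M. \<forall>j<M. i \<noteq> j \<longrightarrow> P i * P j = 0\<^sub>m N N) \<and>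
     mat_sum N P {..<M} = 1\<^sub>m N"

definition outcome_prob :: "(nat \<Rightarrow> complex mat) \<Rightarrow> complex mat \<Rightarrow> nat \<Rightarrow> real" where
  "outcome_prob P \<rho> i = Re (mat_trace (P i * \<rho>))"

definition coarse_grained ::
    "nat \<Rightarrow> nat \<Rightarrow> nat \<Rightarrow> (nat \<Rightarrow> complex mat) \<Rightarrow> complex mat \<Rightarrow> complex mat" where
  "coarse_grained N M r P \<rho> =
     mat_sum N (\<lambda>i. complex_of_real (outcome_prob P \<rho> i / 2 ^ r) \<cdot>\<^sub>m P i) {..<M}"

text \<open>For a real-valued predicate, \<^const>\<open>Least\<close> denotes the minimum, which is attained here because
  the unitary group is compact.\<close>

definition erg_obs ::
    "nat \<Rightarrow> nat \<Rightarrow> nat \<Rightarrow> complex mat \<Rightarrow> (nat \<Rightarrow> complex mat) \<Rightarrow> complex mat \<Rightarrow> real" where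
  "erg_obs N M r H P \<rho> = Re (mat_trace (H * \<rho>)) -
     (LEAST x. \<exists>U. unitary_op N U \<and>
        x = Re (mat_trace (H * U * coarse_grained N M r P \<rho> * mat_adjoint U)))"

text \<open>\<open>e\<close> is the basis adapted to the ranges of the projectors, whose blocks \<open>b 0, \<dots>, b (M - 1)\<close>
  have non-increasing outcome probability; \<open>f\<close> is the energy eigenbasis.\<close>

definition global_unitary ::
    "nat \<Rightarrow> nat \<Rightarrow> nat \<Rightarrow> complex mat \<Rightarrow> (nat \<Rightarrow> complex mat) \<Rightarrow> complex mat \<Rightarrow> complex mat \<Rightarrow> bool"
  where
  "global_unitary N M r H P \<rho> U \<longleftrightarrow> unitary_op N U \<and>
     (\<exists>b e f (E :: nat \<Rightarrow> real).
        bij_betw b {..<M} {..<M} \<and>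
        (\<forall>k<M. \<forall>l<M. k \<le> l \<longrightarrow> outcome_prob P \<rho> (b l) \<le> outcome_prob P \<rho> (b k)) \<and>
        orthonormal_basis N e \<and>
        (\<forall>k<N. e k \<in> op_range (P (b (k div 2 ^ r)))) \<and>
        orthonormal_basis N f \<and>
        (\<forall>k<N. H *\<^sub>v f k = complex_of_real (E k) \<cdot>\<^sub>v f k) \<and>
        (\<forall>k<N. \<forall>l<N. k \<le> l \<longrightarrow> E k \<le> E l) \<and>
        (\<forall>k<N. U *\<^sub>v e k = f k))"

subsection \<open>The work-extraction protocol\<close>

text \<open>The identification of \<open>\<complex>\<^sup>N\<close> with \<open>\<complex>\<^sup>M \<otimes> (\<complex>\<^sup>2)\<^sup>\<otimes>\<^sup>r\<close> is a unitary \<open>V\<close> from the tensor product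
  to \<open>\<complex>\<^sup>N\<close>; an operator \<open>A\<close> on the tensor product acts on \<open>\<complex>\<^sup>N\<close> as \<open>V A V\<^sup>\<dagger>\<close>.\<close>

definition tensor_identification ::
    "nat \<Rightarrow> nat \<Rightarrow> nat \<Rightarrow> (nat \<Rightarrow> complex mat) \<Rightarrow> complex mat \<Rightarrow> bool" where
  "tensor_identification N M r P V \<longleftrightarrow> unitary_op N V \<and>
     (\<forall>i<M. P i = V * kron (basis_projector M i) (1\<^sub>m (2 ^ r)) * mat_adjoint V)"

definition post_measurement ::
    "nat \<Rightarrow> nat \<Rightarrow> (nat \<Rightarrow> complex mat) \<Rightarrow> complex mat \<Rightarrow> complex mat" where
  "post_measurement N M P \<rho> = mat_sum N (\<lambda>i. P i * \<rho> * P i) {..<M}"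

definition rotated_state ::
    "nat \<Rightarrow> nat \<Rightarrow> (nat \<Rightarrow> complex mat) \<Rightarrow> complex mat \<Rightarrow> complex mat \<Rightarrow> complex mat \<Rightarrow> complex mat
      \<Rightarrow> complex mat" where
  "rotated_state N M P V Ugl \<rho> Ur =
     (let W = Ugl * (V * kron (1\<^sub>m M) Ur * mat_adjoint V)
      in W * post_measurement N M P \<rho> * mat_adjoint W)"

definition protocol_iteration ::
    "nat \<Rightarrow> nat \<Rightarrow> nat \<Rightarrow> complex mat \<Rightarrow> (nat \<Rightarrow> complex mat) \<Rightarrow> complex mat \<Rightarrow> complex mat
      \<Rightarrow> complex mat \<Rightarrow> real pmf" where
  "protocol_iteration N M r H P V Ugl \<rho> =
     bind_pmf (bernoulli_pmf (1 / 2)) (\<lambda>c.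
       if c then measure_observable H \<rho>
       else bind_pmf (pmf_of_set (pauli_group r)) (\<lambda>Ur.
         measure_observable (- H) (rotated_state N M P V Ugl \<rho> Ur)))"

definition protocol_output ::
    "nat \<Rightarrow> nat \<Rightarrow> nat \<Rightarrow> complex mat \<Rightarrow> (nat \<Rightarrow> complex mat) \<Rightarrow> complex mat \<Rightarrow> complex mat
      \<Rightarrow> complex mat \<Rightarrow> nat \<Rightarrow> real pmf" where
  "protocol_output N M r H P V Ugl \<rho> T =
     map_pmf (\<lambda>\<mu>. 2 / real T * (\<Sum>j=1..T. \<mu> j))
       (Pi_pmf {1..T} 0 (\<lambda>_. protocol_iteration N M r H P V Ugl \<rho>))"

end

theory Submission
  imports Defs "HOL-Probability.Hoeffding"
begin

text \<open>Each iteration is an unbiased estimator of half the observational ergotropy: averaging over the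
  Pauli group sends every block of the post-measurement state to a multiple of the identity, so the
  second branch sees on average \<open>U\<^sub>g\<^sub>l\<close> applied to the coarse-grained state, whose energy is minimal on its
  unitary orbit by a rearrangement inequality. The outcomes lie in \<open>[- \<parallel>H\<parallel>, \<parallel>H\<parallel>]\<close>, so Hoeffding's
  inequality gives the claim with \<open>C = 8\<close>.\<close>

subsection \<open>Matrices, adjoints and orthonormal bases\<close>

text \<open>The Pauli twirl alone does not produce the coarse-grained state. In
  \<open>1 \<otimes> U\<close> the same \<open>U\<close> acts on every block, so a coherence between
  two different blocks is averaged to a multiple of the identity given by its trace, not to zero.
  The measurement whose outcome is ignored removes exactly these terms beforehand; each remaining
  diagonal block then becomes its trace \<open>p_i\<close> divided by \<open>2 ^ r\<close>, times
  the identity. Different group elements lead to different outcome distributions. Only their means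
  have to average correctly, and the energy is linear in the state, so the twirl may be carried out
  inside a trace. Eigenprojectors, outcome laws and the minimal energy are given by
  \<open>THE\<close>, \<open>embed_pmf\<close> and \<open>LEAST\<close>. Each of them is evaluated
  through an explicit diagonalisation: \<open>H\<close> in the energy eigenbasis contained in
  \<open>global_unitary\<close>, the coarse-grained state in the adapted basis contained there as
  well.\<close>

lemma mat_adjoint_carrier [simp]: "A \<in> carrier_mat n m \<Longrightarrow> mat_adjoint A \<in> carrier_mat m n"
  unfolding mat_adjoint_def by auto

lemma dim_mat_adjoint [simp]:
  "dim_row (mat_adjoint A) = dim_col A" "dim_col (mat_adjoint A) = dim_row A"
  unfolding mat_adjoint_def by auto

lemma index_mat_adjoint [simp]:
  "i < dim_col A \<Longrightarrow> j < dim_row A \<Longrightarrow> mat_adjoint A $$ (i, j) = cnj (A $$ (j, i))"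
  unfolding mat_adjoint_def by (simp add: mat_of_rows_index)

lemma mat_adjoint_adjoint [simp]: "mat_adjoint (mat_adjoint (A :: complex mat)) = A"
  by (rule eq_matI) auto

lemma mat_adjoint_mult:
  fixes A B :: "complex mat"
  assumes "A \<in> carrier_mat n m" "B \<in> carrier_mat m k"
  shows "mat_adjoint (A * B) = mat_adjoint B * mat_adjoint A"
  by (rule eq_matI) (use assms in \<open>auto simp: scalar_prod_def mult_ac intro!: sum.cong\<close>)

lemma mat_adjoint_mult_vec_scalar_prod:
  fixes A :: "complex mat"
  assumes "A \<in> carrier_mat n m" "v \<in> carrier_vec m" "w \<in> carrier_vec n"
  shows "(A *\<^sub>v v) \<bullet>c w = v \<bullet>c (mat_adjoint A *\<^sub>v w)"
proof -
  have "(A *\<^sub>v v) \<bullet>c w = (\<Sum>i<n. \<Sum>j<m. A $$ (i, j) * vec_index v j * cnj (vec_index w i))"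
    using assms by (auto simp: scalar_prod_def sum_distrib_right atLeast0LessThan intro!: sum.cong)
  also have "\<dots> = (\<Sum>j<m. \<Sum>i<n. A $$ (i, j) * vec_index v j * cnj (vec_index w i))"
    by (rule sum.swap)
  also have "\<dots> = v \<bullet>c (mat_adjoint A *\<^sub>v w)"
    using assms
    by (auto simp: scalar_prod_def sum_distrib_left atLeast0LessThan mult_ac intro!: sum.cong)
  finally show ?thesis .
qed

lemma index_mult_mat_sum:
  assumes "A \<in> carrier_mat n m" "B \<in> carrier_mat m k" "i < n" "j < k"
  shows "(A * B) $$ (i, j) = (\<Sum>l<m. A $$ (i, l) * B $$ (l, j))"
  using assms by (auto simp: scalar_prod_def atLeast0LessThan intro!: sum.cong)

lemma mat_trace_mult:
  assumes "A \<in> carrier_mat n m" "B \<in> carrier_mat m n"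
  shows "mat_trace (A * B) = (\<Sum>i<n. \<Sum>j<m. A $$ (i, j) * B $$ (j, i))"
  using assms by (auto simp: mat_trace_def scalar_prod_def atLeast0LessThan intro!: sum.cong)

lemma mat_trace_comm:
  assumes "A \<in> carrier_mat n m" "B \<in> carrier_mat m n"
  shows "mat_trace (A * B) = mat_trace (B * A)"
  unfolding mat_trace_mult[OF assms] mat_trace_mult[OF assms(2,1)]
  by (subst sum.swap) (simp add: mult.commute)

lemma mat_trace_diag_mult:
  assumes "B \<in> carrier_mat n n"
  shows "mat_trace (mat_diag n c * B) = (\<Sum>i<n. c i * B $$ (i, i))"
  using assms by (simp add: mat_diag_mult_left[OF assms] mat_trace_def)

lemma mat_sum_carrier [simp]: "mat_sum n A I \<in> carrier_mat n n"
  by (simp add: mat_sum_def)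

lemma dim_mat_sum [simp]: "dim_row (mat_sum n A I) = n" "dim_col (mat_sum n A I) = n"
  by (simp_all add: mat_sum_def)

lemma index_mat_sum [simp]:
  "i < n \<Longrightarrow> j < n \<Longrightarrow> mat_sum n A I $$ (i, j) = (\<Sum>k\<in>I. A k $$ (i, j))"
  by (simp add: mat_sum_def)

lemma mat_sum_mult_left:
  assumes "B \<in> carrier_mat n n" "\<And>i. i \<in> I \<Longrightarrow> A i \<in> carrier_mat n n"
  shows "B * mat_sum n A I = mat_sum n (\<lambda>i. B * A i) I"
proof (rule eq_matI)
  fix a b assume "a < dim_row (mat_sum n (\<lambda>i. B * A i) I)" "b < dim_col (mat_sum n (\<lambda>i. B * A i) I)"
  then have ab: "a < n" "b < n" by simp_all
  have "(B * mat_sum n A I) $$ (a, b) = (\<Sum>c<n. \<Sum>i\<in>I. B $$ (a, c) * A i $$ (c, b))"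
    using assms ab by (simp add: scalar_prod_def sum_distrib_left atLeast0LessThan)
  also have "\<dots> = (\<Sum>i\<in>I. \<Sum>c<n. B $$ (a, c) * A i $$ (c, b))"
    by (rule sum.swap)
  also have "\<dots> = (\<Sum>i\<in>I. (B * A i) $$ (a, b))"
    using assms ab by (intro sum.cong) (auto simp: index_mult_mat_sum[of _ n n _ n])
  finally show "(B * mat_sum n A I) $$ (a, b) = mat_sum n (\<lambda>i. B * A i) I $$ (a, b)"
    using ab by simp
qed (use assms in auto)

lemma mat_sum_mult_right:
  assumes "B \<in> carrier_mat n n" "\<And>i. i \<in> I \<Longrightarrow> A i \<in> carrier_mat n n"
  shows "mat_sum n A I * B = mat_sum n (\<lambda>i. A i * B) I"
proof (rule eq_matI)
  fix a b assume "a < dim_row (mat_sum n (\<lambda>i. A i * B) I)" "b < dim_col (mat_sum n (\<lambda>i. A i * B) I)"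
  then have ab: "a < n" "b < n" by simp_all
  have "(mat_sum n A I * B) $$ (a, b) = (\<Sum>c<n. \<Sum>i\<in>I. A i $$ (a, c) * B $$ (c, b))"
    using assms ab by (simp add: scalar_prod_def sum_distrib_right atLeast0LessThan)
  also have "\<dots> = (\<Sum>i\<in>I. \<Sum>c<n. A i $$ (a, c) * B $$ (c, b))"
    by (rule sum.swap)
  also have "\<dots> = (\<Sum>i\<in>I. (A i * B) $$ (a, b))"
    using assms ab by (intro sum.cong) (auto simp: index_mult_mat_sum[of _ n n _ n])
  finally show "(mat_sum n A I * B) $$ (a, b) = mat_sum n (\<lambda>i. A i * B) I $$ (a, b)"
    using ab by simp
qed (use assms in auto)

lemma mat_sum_cong: "(\<And>i. i \<in> I \<Longrightarrow> A i = B i) \<Longrightarrow> mat_sum n A I = mat_sum n B I"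
  by (simp add: mat_sum_def)

lemma mat_trace_mat_sum:
  assumes "\<And>i. i \<in> I \<Longrightarrow> A i \<in> carrier_mat n n"
  shows "mat_trace (mat_sum n A I) = (\<Sum>i\<in>I. mat_trace (A i))"
proof -
  have "mat_trace (mat_sum n A I) = (\<Sum>a<n. \<Sum>i\<in>I. A i $$ (a, a))"
    by (simp add: mat_trace_def mat_sum_def)
  also have "\<dots> = (\<Sum>i\<in>I. \<Sum>a<n. A i $$ (a, a))"
    by (rule sum.swap)
  also have "\<dots> = (\<Sum>i\<in>I. mat_trace (A i))"
    using assms by (intro sum.cong) (auto simp: mat_trace_def)
  finally show ?thesis .
qed

lemma unitary_opD:
  assumes "unitary_op N U"
  shows "U \<in> carrier_mat N N" "mat_adjoint U \<in> carrier_mat N N"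
    "mat_adjoint U * U = 1\<^sub>m N" "U * mat_adjoint U = 1\<^sub>m N"
  using assms by (auto simp: unitary_op_def)

lemma unitary_op_adjoint: "unitary_op N U \<Longrightarrow> unitary_op N (mat_adjoint U)"
  by (auto simp: unitary_op_def)

text \<open>Once products are nested to the right by associativity, a pair of mutual inverses
  appears in the shape \<open>A * (B * X)\<close>; this form cancels it inside a longer
  product.\<close>

lemma mat_mult_cancel_left:
  fixes A :: "complex mat"
  assumes "A \<in> carrier_mat n n" "B \<in> carrier_mat n n" "A * B = 1\<^sub>m n" "X \<in> carrier_mat n k"
  shows "A * (B * X) = X"
  using assms assoc_mult_mat[OF assms(1,2,4)] by simp

lemma unitary_op_mult:
  assumes "unitary_op N U" "unitary_op N V"
  shows "unitary_op N (U * V)"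
proof -
  note u = unitary_opD[OF assms(1)] and v = unitary_opD[OF assms(2)]
  have "mat_adjoint V * mat_adjoint U * (U * V) = mat_adjoint V * (mat_adjoint U * (U * V))"
    using u v by (intro assoc_mult_mat) auto
  moreover have "U * V * (mat_adjoint V * mat_adjoint U) = U * (V * (mat_adjoint V * mat_adjoint U))"
    using u v by (intro assoc_mult_mat) auto
  ultimately show ?thesis
    using u v unfolding unitary_op_def
    by (simp add: mat_adjoint_mult[of _ N N] mat_mult_cancel_left[of _ N])
qed

lemma mat_trace_unitary_conj:
  assumes "unitary_op N U" "A \<in> carrier_mat N N"
  shows "mat_trace (mat_adjoint U * A * U) = mat_trace A"
proof -
  note [simp] = unitary_opD[OF assms(1)] assms(2)
  have "mat_trace (mat_adjoint U * A * U) = mat_trace (U * (mat_adjoint U * A))"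
    by (rule mat_trace_comm[of _ N N]) (auto intro!: mult_carrier_mat[of _ N N])
  also have "U * (mat_adjoint U * A) = (U * mat_adjoint U) * A"
    by (rule assoc_mult_mat[of _ N N _ N _ N, symmetric]) auto
  finally show ?thesis using assms(2) by simp
qed

definition basis_mat :: "nat \<Rightarrow> (nat \<Rightarrow> complex Matrix.vec) \<Rightarrow> complex mat" where
  "basis_mat N e = Matrix.mat N N (\<lambda>(i, k). vec_index (e k) i)"

lemma basis_mat_carrier [simp]: "basis_mat N e \<in> carrier_mat N N"
  by (simp add: basis_mat_def)

lemma col_basis_mat: "orthonormal_basis N e \<Longrightarrow> k < N \<Longrightarrow> col (basis_mat N e) k = e k"
  by (rule eq_vecI) (auto simp: basis_mat_def orthonormal_basis_def)

lemma unitary_basis_mat: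
  assumes "orthonormal_basis N e"
  shows "unitary_op N (basis_mat N e)"
proof -
  have "mat_adjoint (basis_mat N e) * basis_mat N e = 1\<^sub>m N"
  proof (rule eq_matI)
    fix i j assume ij: "i < dim_row (1\<^sub>m N :: complex mat)" "j < dim_col (1\<^sub>m N :: complex mat)"
    have d: "dim_vec (e i) = N"
      using assms ij by (auto simp: orthonormal_basis_def)
    from ij have "(mat_adjoint (basis_mat N e) * basis_mat N e) $$ (i, j) =
        (\<Sum>l<N. vec_index (e j) l * cnj (vec_index (e i) l))"
      by (subst index_mult_mat_sum[of _ N N _ N]) (auto simp: basis_mat_def mult_ac intro!: sum.cong)
    also have "\<dots> = e j \<bullet>c e i"
      using d ij by (auto simp: scalar_prod_def atLeast0LessThan intro!: sum.cong)
    also have "\<dots> = 1\<^sub>m N $$ (i, j)"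
      using assms ij by (auto simp: orthonormal_basis_def)
    finally show "(mat_adjoint (basis_mat N e) * basis_mat N e) $$ (i, j) = 1\<^sub>m N $$ (i, j)" .
  qed (auto simp: basis_mat_def)
  then show ?thesis
    by (auto simp: unitary_op_def intro: mat_mult_left_right_inverse[of "mat_adjoint (basis_mat N e)"])
qed

lemma mult_basis_mat_eq_diag:
  assumes "A \<in> carrier_mat N N" "orthonormal_basis N e"
    and ev: "\<And>k. k < N \<Longrightarrow> A *\<^sub>v e k = c k \<cdot>\<^sub>v e k"
  shows "A * basis_mat N e = basis_mat N e * mat_diag N c"
proof (rule eq_matI)
  fix i k assume "i < dim_row (basis_mat N e * mat_diag N c)" "k < dim_col (basis_mat N e * mat_diag N c)"
  then have ik: "i < N" "k < N" by (auto simp: basis_mat_def mat_diag_def)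
  then have "(A * basis_mat N e) $$ (i, k) = Matrix.row A i \<bullet> col (basis_mat N e) k"
    using assms(1) by (intro index_mult_mat) (auto simp: basis_mat_def)
  also have "\<dots> = vec_index (A *\<^sub>v e k) i"
    using ik assms(1) by (simp add: col_basis_mat[OF assms(2)])
  also have "\<dots> = (basis_mat N e * mat_diag N c) $$ (i, k)"
    using ik assms(2)
    by (simp add: ev mat_diag_mult_right[of _ N] orthonormal_basis_def) (auto simp: basis_mat_def)
  finally show "(A * basis_mat N e) $$ (i, k) = (basis_mat N e * mat_diag N c) $$ (i, k)" .
qed (use assms in \<open>auto simp: basis_mat_def mat_diag_def\<close>)

text \<open>The eigenvalue equations say \<open>A * F = F * D\<close> for the unitary
  \<open>F\<close> with the basis vectors as columns; multiplying by the adjoint of \<open>F\<close>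
  on the right isolates \<open>A\<close>.\<close>

lemma diagonalization:
  assumes "A \<in> carrier_mat N N" "orthonormal_basis N e"
    and "\<And>k. k < N \<Longrightarrow> A *\<^sub>v e k = c k \<cdot>\<^sub>v e k"
  shows "A = basis_mat N e * mat_diag N c * mat_adjoint (basis_mat N e)"
proof -
  note u = unitary_opD[OF unitary_basis_mat[OF assms(2)]]
  have "A = A * (basis_mat N e * mat_adjoint (basis_mat N e))"
    using assms u by simp
  also have "\<dots> = A * basis_mat N e * mat_adjoint (basis_mat N e)"
    using assms u by (intro assoc_mult_mat[of _ N N _ N _ N, symmetric]) auto
  finally show ?thesis
    using mult_basis_mat_eq_diag[OF assms] by simp
qed

subsection \<open>Measuring an observable with a known eigenbasis\<close>

lemma euclid_norm_eq:
  assumes "v \<in> carrier_vec n"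
  shows "euclid_norm v = sqrt (\<Sum>i<n. (cmod (vec_index v i))\<^sup>2)"
proof -
  have "Re (vec_index v i * cnj (vec_index v i)) = (cmod (vec_index v i))\<^sup>2" for i
    by (metis complex_norm_square Re_complex_of_real)
  then show ?thesis
    using assms by (auto simp: euclid_norm_def scalar_prod_def atLeast0LessThan)
qed

lemma abs_eigenvalue_le_spectral_norm:
  assumes A: "A \<in> carrier_mat N N" and v: "v \<in> carrier_vec N" "euclid_norm v = 1"
    and ev: "A *\<^sub>v v = complex_of_real c \<cdot>\<^sub>v v"
  shows "\<bar>c\<bar> \<le> spectral_norm A"
proof -
  let ?S = "{euclid_norm (A *\<^sub>v v) | v. v \<in> carrier_vec (dim_col A) \<and> euclid_norm v = 1}"
  have "euclid_norm (A *\<^sub>v v) = sqrt (\<Sum>i<N. (\<bar>c\<bar> * cmod (vec_index v i))\<^sup>2)"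
    using A v by (subst euclid_norm_eq[of _ N]) (auto simp: ev norm_mult)
  also have "\<dots> = \<bar>c\<bar> * euclid_norm v"
    using v(1) by (simp add: euclid_norm_eq[of _ N] power_mult_distrib flip: sum_distrib_left)
      (simp add: real_sqrt_mult)
  finally have c: "\<bar>c\<bar> = euclid_norm (A *\<^sub>v v)"
    using v(2) by simp
  \<comment> \<open>A real \<open>Sup\<close> dominates the members of its set only if the set is
    bounded above. Coordinates of a unit vector have modulus at most 1, so absolute row sums give a
    crude but sufficient bound.\<close>
  have bdd: "x \<le> sqrt (\<Sum>i<N. (\<Sum>j<N. cmod (A $$ (i, j)))\<^sup>2)" if "x \<in> ?S" for x
  proof -
    from that A obtain w where w: "w \<in> carrier_vec N" "euclid_norm w = 1" "x = euclid_norm (A *\<^sub>v w)"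
      by auto
    have w1: "cmod (vec_index w j) \<le> 1" if "j < N" for j
    proof -
      have "(cmod (vec_index w j))\<^sup>2 \<le> (\<Sum>i<N. (cmod (vec_index w i))\<^sup>2)"
        using that by (intro member_le_sum) auto
      also have "\<dots> = 1"
        using w(1,2) by (simp add: euclid_norm_eq)
      finally show ?thesis
        by (simp add: power_le_one_iff abs_square_le_1)
    qed
    have "cmod (vec_index (A *\<^sub>v w) i) \<le> (\<Sum>j<N. cmod (A $$ (i, j)))" if "i < N" for i
    proof -
      have "vec_index (A *\<^sub>v w) i = (\<Sum>j<N. A $$ (i, j) * vec_index w j)"
        using that A w(1) by (auto simp: scalar_prod_def atLeast0LessThan)
      also have "cmod \<dots> \<le> (\<Sum>j<N. cmod (A $$ (i, j) * vec_index w j))"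
        by (rule norm_sum)
      also have "\<dots> \<le> (\<Sum>j<N. cmod (A $$ (i, j)))"
        using w1 by (intro sum_mono) (auto simp: norm_mult intro: mult_left_le)
      finally show ?thesis .
    qed
    then show ?thesis
      using A w(1) unfolding w(3)
      by (subst euclid_norm_eq[of _ N]) (auto intro!: sum_mono power_mono)
  qed
  show ?thesis
    unfolding spectral_norm_def c
    by (rule cSup_upper) (use A v bdd in \<open>auto intro!: bdd_aboveI\<close>)
qed

text \<open>Diagonal entries in a new basis are values of the quadratic form; this turns positivity
  of a state into non-negative outcome weights.\<close>

lemma index_adjoint_conj:
  fixes S \<sigma> :: "complex mat"
  assumes "S \<in> carrier_mat N N" "\<sigma> \<in> carrier_mat N N" "k < N"
  shows "(mat_adjoint S * \<sigma> * S) $$ (k, k) = (\<sigma> *\<^sub>v col S k) \<bullet>c col S k"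
proof -
  have "mat_adjoint S * \<sigma> * S = mat_adjoint S * (\<sigma> * S)"
    using assms by (intro assoc_mult_mat) auto
  then have "(mat_adjoint S * \<sigma> * S) $$ (k, k) = (\<Sum>l<N. cnj (S $$ (l, k)) * (\<sigma> * S) $$ (l, k))"
    using assms by (simp only:) (subst index_mult_mat_sum[of _ N N _ N], auto)
  also have "\<dots> = (\<sigma> *\<^sub>v col S k) \<bullet>c col S k"
    using assms by (auto simp: scalar_prod_def[of _ "conjugate _"] atLeast0LessThan intro!: sum.cong)
  finally show ?thesis .
qed

text \<open>By cyclicity the outer factors move onto \<open>X\<close>, and the diagonal matrix then
  sees only diagonal entries. Outcome probabilities, mean energies and block probabilities are all
  read off in this way, with \<open>F\<close> unitary and \<open>G\<close> its adjoint.\<close>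

lemma mat_trace_mult_diag_conj:
  assumes "X \<in> carrier_mat N N" "F \<in> carrier_mat N N" "G \<in> carrier_mat N N"
  shows "mat_trace (X * (F * mat_diag N c * G)) = (\<Sum>k<N. c k * (G * X * F) $$ (k, k))"
proof -
  note [simp] = assms mult_carrier_mat[of _ N N _ N] assoc_mult_mat[of _ N N _ N _ N]
  have "mat_trace (X * (F * mat_diag N c * G)) = mat_trace ((X * F * mat_diag N c) * G)"
    by simp
  also have "\<dots> = mat_trace (G * (X * F * mat_diag N c))"
    by (rule mat_trace_comm[of _ N N]) auto
  also have "\<dots> = mat_trace ((G * X * F) * mat_diag N c)"
    by simp
  also have "\<dots> = mat_trace (mat_diag N c * (G * X * F))"
    by (rule mat_trace_comm[of _ N N]) auto
  finally show ?thesis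
    by (simp only: mat_trace_diag_mult mult_carrier_mat[of _ N N _ N] assms)
qed

text \<open>Equal ranges give \<open>Q' * Q = Q\<close> and \<open>Q * Q' = Q'\<close>. Taking
  adjoints in the first identity yields \<open>Q = Q * Q'\<close>, hence \<open>Q = Q'\<close>. This
  is the uniqueness half of evaluating \<open>eigenprojector\<close>.\<close>

lemma projector_eq_of_op_range_eq:
  assumes "projector N Q" "projector N Q'" "op_range Q = op_range Q'"
  shows "Q = Q'"
proof -
  \<comment> \<open>Every column of \<open>A\<close> lies in the range of \<open>B\<close>, and the
    idempotent \<open>B\<close> fixes its range pointwise.\<close>
  have absorb: "B * A = A" if A: "projector N A" and B: "projector N B" and r: "op_range A = op_range B"
    for A B :: "complex mat"
  proof (rule eq_matI)
    have c: "A \<in> carrier_mat N N" "B \<in> carrier_mat N N" and BB: "B * B = B"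
      using A B by (auto simp: projector_def hermitian_op_def)
    fix i j assume "i < dim_row A" "j < dim_col A"
    then have ij: "i < N" "j < N" using c by auto
    have "A *\<^sub>v unit_vec N j \<in> op_range A"
      unfolding op_range_def using c by auto
    then have "A *\<^sub>v unit_vec N j \<in> op_range B"
      by (simp only: r)
    then obtain y where y: "y \<in> carrier_vec N" "A *\<^sub>v unit_vec N j = B *\<^sub>v y"
      unfolding op_range_def using c by auto
    have "B *\<^sub>v (B *\<^sub>v y) = B *\<^sub>v y"
      using c y(1) BB by (metis assoc_mult_mat_vec)
    then have "(B * A) *\<^sub>v unit_vec N j = A *\<^sub>v unit_vec N j"
      using c y by (simp add: assoc_mult_mat_vec[of _ N N _ N])
    moreover have "vec_index (X *\<^sub>v unit_vec N j) i = X $$ (i, j)" if "X \<in> carrier_mat N N" for X :: "complex mat"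
      using that ij scalar_prod_right_unit[of j N "Matrix.row X i"] by simp
    ultimately show "(B * A) $$ (i, j) = A $$ (i, j)"
      using c by (metis mult_carrier_mat)
  qed (use A B in \<open>auto simp: projector_def hermitian_op_def\<close>)
  have "Q = mat_adjoint (Q' * Q)"
    using absorb[OF assms] assms(1) by (simp add: projector_def hermitian_op_def)
  also have "\<dots> = Q * Q'"
    using assms by (auto simp: projector_def hermitian_op_def mat_adjoint_mult[of _ N N])
  finally show ?thesis
    using absorb[OF assms(2,1) assms(3)[symmetric]] by simp
qed

lemma smult_mat_mult_vec:
  assumes "Q \<in> carrier_mat n m" "x \<in> carrier_vec m"
  shows "(c \<cdot>\<^sub>m Q) *\<^sub>v x = c \<cdot>\<^sub>v (Q *\<^sub>v x)"
  by (rule eq_vecI) (use assms in \<open>auto simp: scalar_prod_def sum_distrib_left mult.assoc\<close>)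

context
  fixes N :: nat and A :: "complex mat" and f :: "nat \<Rightarrow> complex Matrix.vec" and E :: "nat \<Rightarrow> real"
  assumes A: "A \<in> carrier_mat N N" and onb: "orthonormal_basis N f"
    and ev: "\<And>k. k < N \<Longrightarrow> A *\<^sub>v f k = complex_of_real (E k) \<cdot>\<^sub>v f k"
begin

lemma abs_eigenbasis_value_le_spectral_norm:
  assumes "k < N"
  shows "\<bar>E k\<bar> \<le> spectral_norm A"
  using assms onb
  by (intro abs_eigenvalue_le_spectral_norm[OF A _ _ ev, of k])
     (auto simp: orthonormal_basis_def euclid_norm_def)

text \<open>The candidate keeps those basis vectors whose value is \<open>l\<close>. Degenerate
  values are covered, and if no \<open>E k\<close> equals \<open>l\<close> the middle factor
  vanishes, which agrees with the zero eigenspace.\<close>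

lemma eigenprojector_eq:
  "eigenprojector A l =
     basis_mat N f * mat_diag N (\<lambda>k. if E k = l then 1 else 0) * mat_adjoint (basis_mat N f)"
proof -
  define F where "F = basis_mat N f"
  define D :: "complex mat" where "D = mat_diag N (\<lambda>k. if E k = l then 1 else 0)"
  define DE where "DE = mat_diag N (\<lambda>k. complex_of_real (E k))"
  define Q where "Q = F * D * mat_adjoint F"
  have F: "F \<in> carrier_mat N N" "mat_adjoint F \<in> carrier_mat N N" "mat_adjoint F * F = 1\<^sub>m N"
      "F * mat_adjoint F = 1\<^sub>m N"
    using unitary_opD[OF unitary_basis_mat[OF onb]] by (auto simp: F_def)
  have D: "D \<in> carrier_mat N N" "DE \<in> carrier_mat N N"
    by (auto simp: D_def DE_def)
  have DD: "D * D = D" "DE * D = complex_of_real l \<cdot>\<^sub>m D"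
    unfolding D_def DE_def mat_diag_diag by (auto simp: mat_diag_def intro!: eq_matI)
  have D_adj: "mat_adjoint D = D"
    by (rule eq_matI) (auto simp: D_def mat_diag_def)
  note [simp] = F(1,2) D(1,2) mult_carrier_mat[of _ N N _ N] assoc_mult_mat[of _ N N _ N _ N]
    assoc_mult_mat_vec[of _ N N _ N] mult_mat_vec_carrier[of _ N N]
  have A_eq: "A = F * DE * mat_adjoint F"
    unfolding F_def DE_def by (rule diagonalization[OF A onb ev])
  have Q: "Q \<in> carrier_mat N N" by (simp add: Q_def)
  have "mat_adjoint Q = Q"
    by (simp add: Q_def mat_adjoint_mult[of _ N N _ N] D_adj)
  moreover have "Q * Q = Q"
  proof -
    have "Q * Q = F * (D * (mat_adjoint F * (F * (D * mat_adjoint F))))"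
      by (simp add: Q_def)
    also have "\<dots> = F * (D * D * mat_adjoint F)"
      using F by (simp add: mat_mult_cancel_left[of _ N _ _ N])
    also have "\<dots> = Q"
      by (simp add: DD Q_def)
    finally show ?thesis .
  qed
  ultimately have proj: "projector N Q"
    using Q by (simp add: projector_def hermitian_op_def)
  have AQ: "A * Q = complex_of_real l \<cdot>\<^sub>m Q"
  proof -
    have "A * Q = F * (DE * (mat_adjoint F * (F * (D * mat_adjoint F))))"
      by (simp add: Q_def A_eq)
    also have "\<dots> = F * (DE * D * mat_adjoint F)"
      using F by (simp add: mat_mult_cancel_left[of _ N _ _ N])
    also have "\<dots> = complex_of_real l \<cdot>\<^sub>m Q"
      by (simp add: DD(2) Q_def mult_smult_assoc_mat[of _ N N _ N] mult_smult_distrib[of _ N N _ N])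
    finally show ?thesis .
  qed
  have range: "op_range Q = {v \<in> carrier_vec N. A *\<^sub>v v = complex_of_real l \<cdot>\<^sub>v v}"
  proof safe
    fix v assume "v \<in> op_range Q"
    then obtain x where x: "x \<in> carrier_vec N" "v = Q *\<^sub>v x"
      using Q by (auto simp: op_range_def)
    show "v \<in> carrier_vec N" using x Q by simp
    have "A *\<^sub>v v = (A * Q) *\<^sub>v x"
      using A Q x by simp
    also have "\<dots> = complex_of_real l \<cdot>\<^sub>v v"
      unfolding AQ x(2) using Q x(1) by (rule smult_mat_mult_vec)
    finally show "A *\<^sub>v v = complex_of_real l \<cdot>\<^sub>v v" .
  next
    fix v assume v: "v \<in> carrier_vec N" "A *\<^sub>v v = complex_of_real l \<cdot>\<^sub>v v"
    \<comment> \<open>In eigenbasis coordinates the equation for \<open>v\<close> reads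
      \<open>E k * w k = l * w k\<close>, so \<open>w\<close> is supported where
      \<open>E k = l\<close> and the indicator matrix \<open>D\<close> fixes it.\<close>
    define w where "w = mat_adjoint F *\<^sub>v v"
    have w: "w \<in> carrier_vec N" using v by (simp add: w_def)
    have "mat_adjoint F *\<^sub>v (A *\<^sub>v v) = (mat_adjoint F * (F * (DE * mat_adjoint F))) *\<^sub>v v"
      using A v(1) by (subst assoc_mult_mat_vec[of _ N N _ N]) (auto simp: A_eq)
    also have "\<dots> = DE *\<^sub>v w"
      using F v(1) by (simp add: mat_mult_cancel_left[of _ N _ _ N] w_def)
    finally have "DE *\<^sub>v w = complex_of_real l \<cdot>\<^sub>v w"
      using v by (simp add: w_def mult_mat_vec[of _ N N])
    then have ew: "vec_index (DE *\<^sub>v w) k = complex_of_real l * vec_index w k" if "k < N" for k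
      using that w by simp
    have diag: "vec_index (mat_diag N c *\<^sub>v w) k = c k * vec_index w k" if "k < N" for c :: "nat \<Rightarrow> complex" and k
    proof -
      have "vec_index (mat_diag N c *\<^sub>v w) k = (\<Sum>j<N. (if k = j then c j else 0) * vec_index w j)"
        using that w by (auto simp: mat_diag_def scalar_prod_def atLeast0LessThan)
      also have "\<dots> = (\<Sum>j<N. (if j = k then c k * vec_index w k else 0))"
        by (intro sum.cong) auto
      finally have "vec_index (mat_diag N c *\<^sub>v w) k = \<dots>" .
      then show ?thesis using that by simp
    qed
    have "D *\<^sub>v w = w"
    proof (rule eq_vecI)
      fix k assume "k < dim_vec w"
      then have k: "k < N" using w by simp
      have "complex_of_real (E k) * vec_index w k = complex_of_real l * vec_index w k"
        using ew[OF k] diag[OF k] by (simp add: DE_def)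
      then show "vec_index (D *\<^sub>v w) k = vec_index w k"
        using diag[OF k] by (auto simp: D_def)
    qed (use w in \<open>auto simp: D_def mat_diag_def\<close>)
    then have "Q *\<^sub>v v = F *\<^sub>v w"
      using v(1) by (simp add: Q_def w_def)
    also have "\<dots> = (F * mat_adjoint F) *\<^sub>v v"
      using v(1) by (simp add: w_def)
    also have "\<dots> = v"
      using F(4) v(1) by simp
    finally have "v = Q *\<^sub>v v" by simp
    with v(1) Q show "v \<in> op_range Q"
      unfolding op_range_def by auto
  qed
  have "dim_row A = N" using A by auto
  then have "eigenprojector A l = Q"
    unfolding eigenprojector_def using proj range
    by (intro the_equality) (auto intro: projector_eq_of_op_range_eq)
  then show ?thesis by (simp add: Q_def F_def D_def)
qed

text \<open>The outcome law is the image under \<open>E\<close> of a law \<open>w\<close> on basis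
  indices. Normalisation is checked for \<open>w\<close>, where it is a finite trace identity, and
  indices with equal energy merge automatically under the image.\<close>

lemma measure_observable_diagonal:
  assumes \<sigma>: "\<sigma> \<in> carrier_mat N N" "\<And>v. v \<in> carrier_vec N \<Longrightarrow> 0 \<le> Re ((\<sigma> *\<^sub>v v) \<bullet>c v)"
    "mat_trace \<sigma> = 1"
  shows "set_pmf (measure_observable A \<sigma>) \<subseteq> E ` {..<N}" (is ?supp)
    and "measure_pmf.expectation (measure_observable A \<sigma>) (\<lambda>x. x) = Re (mat_trace (A * \<sigma>))" (is ?exp)
proof -
  define F where "F = basis_mat N f"
  \<comment> \<open>The value 0 from \<open>N\<close> on makes \<open>w\<close> a mass function on
    all natural numbers.\<close>
  define w where "w k = (if k < N then Re ((mat_adjoint F * \<sigma> * F) $$ (k, k)) else 0)" for k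
  note uF = unitary_basis_mat[OF onb, folded F_def]
  have F: "F \<in> carrier_mat N N" "mat_adjoint F \<in> carrier_mat N N"
    using unitary_opD[OF uF] by auto
  have w_nonneg: "0 \<le> w k" for k
    using \<sigma>(2)[of "col F k"] col_carrier_vec[OF _ F(1), of k]
    by (auto simp only: w_def index_adjoint_conj[OF F(1) \<sigma>(1)] split: if_split)
  have "(\<Sum>k<N. w k) = Re (mat_trace (mat_adjoint F * \<sigma> * F))"
    using F by (simp add: w_def mat_trace_def)
  also have "\<dots> = 1"
    using mat_trace_unitary_conj[OF uF \<sigma>(1)] \<sigma>(3) by simp
  finally have w_sum: "(\<Sum>k<N. w k) = 1" .
  define W where "W = embed_pmf w"
  have "(\<integral>\<^sup>+k. ennreal (w k) \<partial>count_space UNIV) = (\<Sum>k<N. ennreal (w k))"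
    by (rule nn_integral_count_space') (auto simp: w_def)
  also have "\<dots> = 1"
    using w_nonneg w_sum by (simp add: sum_ennreal)
  finally have pmf_W: "pmf W k = w k" for k
    unfolding W_def using w_nonneg by (intro pmf_embed_pmf) auto
  have "Re (mat_trace (\<sigma> * eigenprojector A l)) = pmf (map_pmf E W) l" for l
  proof -
    have "pmf (map_pmf E W) l = measure_pmf.prob W {k. k < N \<and> E k = l}"
      unfolding pmf_map by (rule measure_prob_cong_0) (auto simp: pmf_W w_def)
    also have "\<dots> = (\<Sum>k\<in>{k\<in>{..<N}. E k = l}. w k)"
      by (subst measure_measure_pmf_finite) (auto simp: pmf_W)
    also have "\<dots> = (\<Sum>k<N. if E k = l then w k else 0)"
      by (rule sum.inter_filter) auto
    also have "\<dots> = Re (mat_trace (\<sigma> * eigenprojector A l))"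
      unfolding eigenprojector_eq F_def[symmetric] mat_trace_mult_diag_conj[OF \<sigma>(1) F]
      by (auto simp: w_def intro!: sum.cong)
    finally show ?thesis ..
  qed
  \<comment> \<open>\<open>embed_pmf\<close> is a left inverse of \<open>pmf\<close>, so agreement
    with the mass function of an existing distribution already identifies the result.\<close>
  then have mo: "measure_observable A \<sigma> = map_pmf E W"
    unfolding measure_observable_def
    using type_definition.Rep_inverse[OF td_pmf_embed_pmf, of "map_pmf E W"] by simp
  have set_W: "set_pmf W \<subseteq> {..<N}"
    by (auto simp: set_pmf_iff pmf_W w_def split: if_splits)
  then show ?supp
    by (auto simp: mo)
  have A_eq: "A = F * mat_diag N (\<lambda>k. complex_of_real (E k)) * mat_adjoint F"
    unfolding F_def by (rule diagonalization[OF A onb ev])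
  have "mat_trace (A * \<sigma>) = mat_trace (\<sigma> * A)"
    by (rule mat_trace_comm[OF A \<sigma>(1)])
  also have "\<dots> = (\<Sum>k<N. complex_of_real (E k) * (mat_adjoint F * \<sigma> * F) $$ (k, k))"
    by (subst A_eq, rule mat_trace_mult_diag_conj[OF \<sigma>(1) F])
  finally have "Re (mat_trace (A * \<sigma>)) = (\<Sum>k<N. E k * w k)"
    by (simp add: w_def)
  also have "\<dots> = measure_pmf.expectation W E"
    using set_W by (subst integral_measure_pmf_real[of "{..<N}"]) (auto simp: pmf_W)
  finally show ?exp
    by (simp add: mo)
qed

end

subsection \<open>The Pauli group\<close>

text \<open>This is the index convention of \<open>kron\<close>: position \<open>l\<close> encodes
  the pair \<open>(l div n, l mod n)\<close>, the first component naming the block and the second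
  the place inside it.\<close>

lemma sum_div_mod:
  fixes f :: "nat \<Rightarrow> nat \<Rightarrow> 'a :: comm_monoid_add"
  assumes "0 < n"
  shows "(\<Sum>l<m * n. f (l div n) (l mod n)) = (\<Sum>a<m. \<Sum>b<n. f a b)"
proof -
  have "(\<Sum>l<m * n. f (l div n) (l mod n)) = (\<Sum>(a, b)\<in>{..<m} \<times> {..<n}. f a b)"
  proof (rule sum.reindex_bij_witness[of _ "\<lambda>(a, b). a * n + b" "\<lambda>l. (l div n, l mod n)"])
    fix x assume x: "x \<in> {..<m} \<times> {..<n}"
    then have "fst x * n + snd x < (fst x + 1) * n" by auto
    also have "\<dots> \<le> m * n" using x by (intro mult_right_mono) auto
    finally show "(case x of (a, b) \<Rightarrow> a * n + b) \<in> {..<m * n}"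
      by (simp add: case_prod_unfold)
    show "((case x of (a, b) \<Rightarrow> a * n + b) div n, (case x of (a, b) \<Rightarrow> a * n + b) mod n) = x"
      using x by (simp add: case_prod_unfold mem_Times_iff)
  next
    fix l assume "l \<in> {..<m * n}"
    then show "(l div n, l mod n) \<in> {..<m} \<times> {..<n}"
      using assms by (simp add: less_mult_imp_div_less)
  qed simp_all
  then show ?thesis by (simp add: sum.cartesian_product)
qed

section \<open>Kronecker products\<close>

lemma kron_carrier [simp]:
  "A \<in> carrier_mat a b \<Longrightarrow> B \<in> carrier_mat c d \<Longrightarrow> kron A B \<in> carrier_mat (a * c) (b * d)"
  by (auto simp: kron_def)

lemma index_kron:
  assumes "A \<in> carrier_mat a b" "B \<in> carrier_mat c d" "i < a * c" "j < b * d"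
  shows "kron A B $$ (i, j) = A $$ (i div c, j div d) * B $$ (i mod c, j mod d)"
  using assms by (auto simp: kron_def)

lemma kron_smult_right: "kron A (c \<cdot>\<^sub>m B) = c \<cdot>\<^sub>m kron A B"
proof (rule eq_matI)
  fix i j assume "i < dim_row (c \<cdot>\<^sub>m kron A B)" "j < dim_col (c \<cdot>\<^sub>m kron A B)"
  then have ij: "i < dim_row A * dim_row B" "j < dim_col A * dim_col B"
    by (auto simp: kron_def)
  then have "0 < dim_row B" "0 < dim_col B" by (auto intro: gr0I)
  with ij show "kron A (c \<cdot>\<^sub>m B) $$ (i, j) = (c \<cdot>\<^sub>m kron A B) $$ (i, j)"
    by (simp add: kron_def)
qed (auto simp: kron_def)

lemma kron_one: "0 < n \<Longrightarrow> kron (1\<^sub>m m) (1\<^sub>m n) = 1\<^sub>m (m * n)"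
  by (rule eq_matI)
     (auto simp: kron_def less_mult_imp_div_less, metis div_mult_mod_eq)

text \<open>The mixed-product rule: the summation index splits into its two components and the
  double sum factorises. Positive inner dimensions make the splitting by \<open>div\<close> and
  \<open>mod\<close> valid.\<close>

lemma kron_mult:
  assumes "A \<in> carrier_mat a b" "C \<in> carrier_mat b c"
    and "B \<in> carrier_mat a' b'" "D \<in> carrier_mat b' c'" and pos: "0 < a'" "0 < b'" "0 < c'"
  shows "kron A B * kron C D = kron (A * C) (B * D)"
proof (rule eq_matI)
  fix i j assume "i < dim_row (kron (A * C) (B * D))" "j < dim_col (kron (A * C) (B * D))"
  then have ij: "i < a * a'" "j < c * c'"
    using assms by (auto simp: kron_def)
  have ij': "i div a' < a" "i mod a' < a'" "j div c' < c" "j mod c' < c'"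
    using ij pos by (auto simp: less_mult_imp_div_less)
  have "(kron A B * kron C D) $$ (i, j) =
      (\<Sum>l<b * b'. kron A B $$ (i, l) * kron C D $$ (l, j))"
    by (rule index_mult_mat_sum[OF kron_carrier kron_carrier]) (use assms ij in auto)
  also have "\<dots> = (\<Sum>l<b * b'. A $$ (i div a', l div b') * B $$ (i mod a', l mod b') *
      (C $$ (l div b', j div c') * D $$ (l mod b', j mod c')))"
    using assms ij by (intro sum.cong) (auto simp: index_kron)
  also have "\<dots> = (\<Sum>k<b. \<Sum>l<b'. A $$ (i div a', k) * B $$ (i mod a', l) *
      (C $$ (k, j div c') * D $$ (l, j mod c')))"
    by (rule sum_div_mod[OF pos(2)])
  also have "\<dots> = (\<Sum>k<b. A $$ (i div a', k) * C $$ (k, j div c')) *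
      (\<Sum>l<b'. B $$ (i mod a', l) * D $$ (l, j mod c'))"
    by (simp add: sum_product mult_ac)
  also have "\<dots> = (A * C) $$ (i div a', j div c') * (B * D) $$ (i mod a', j mod c')"
    using assms ij' by (simp only: index_mult_mat_sum)
  also have "\<dots> = kron (A * C) (B * D) $$ (i, j)"
    using assms ij by (subst index_kron[of _ a c _ a' c']) auto
  finally show "(kron A B * kron C D) $$ (i, j) = kron (A * C) (B * D) $$ (i, j)" .
qed (use assms in \<open>auto simp: kron_def\<close>)

lemma mat_adjoint_kron: "mat_adjoint (kron A B) = kron (mat_adjoint A) (mat_adjoint B)"
proof (rule eq_matI)
  fix i j assume "i < dim_row (kron (mat_adjoint A) (mat_adjoint B))"
    "j < dim_col (kron (mat_adjoint A) (mat_adjoint B))"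
  then have ij: "i < dim_col A * dim_col B" "j < dim_row A * dim_row B"
    by (auto simp: kron_def)
  then have "0 < dim_col B" "0 < dim_row B" by (auto intro: gr0I)
  with ij show "mat_adjoint (kron A B) $$ (i, j) = kron (mat_adjoint A) (mat_adjoint B) $$ (i, j)"
    by (simp add: kron_def less_mult_imp_div_less)
qed (auto simp: kron_def)

lemma unitary_op_one: "unitary_op n (1\<^sub>m n)"
proof -
  have "mat_adjoint (1\<^sub>m n :: complex mat) = 1\<^sub>m n"
    by (rule eq_matI) auto
  then show ?thesis by (simp add: unitary_op_def)
qed

lemma unitary_op_kron:
  assumes "unitary_op m A" "unitary_op n B" "0 < n"
  shows "unitary_op (m * n) (kron A B)"
  using unitary_opD[OF assms(1)] unitary_opD[OF assms(2)] assms(3)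
  by (simp add: unitary_op_def mat_adjoint_kron kron_mult[of _ m m _ m _ n n _ n] kron_one)

section \<open>The four single-qubit Pauli matrices\<close>

abbreviation single_paulis :: "complex mat set" where
  "single_paulis \<equiv> {1\<^sub>m 2, pauli_X, pauli_Y, pauli_Z}"

lemma pauli_carrier [simp]:
  "pauli_X \<in> carrier_mat 2 2" "pauli_Y \<in> carrier_mat 2 2" "pauli_Z \<in> carrier_mat 2 2"
  by (auto simp: pauli_X_def pauli_Y_def pauli_Z_def mat_of_rows_list_def)

lemma single_paulis_carrier: "s \<in> single_paulis \<Longrightarrow> s \<in> carrier_mat 2 2"
  by auto

lemma index_pauli [simp]:
  "pauli_X $$ (0, 0) = 0" "pauli_X $$ (0, Suc 0) = 1" "pauli_X $$ (Suc 0, 0) = 1" "pauli_X $$ (Suc 0, Suc 0) = 0"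
  "pauli_Y $$ (0, 0) = 0" "pauli_Y $$ (0, Suc 0) = - \<i>" "pauli_Y $$ (Suc 0, 0) = \<i>" "pauli_Y $$ (Suc 0, Suc 0) = 0"
  "pauli_Z $$ (0, 0) = 1" "pauli_Z $$ (0, Suc 0) = 0" "pauli_Z $$ (Suc 0, 0) = 0" "pauli_Z $$ (Suc 0, Suc 0) = - 1"
  by (simp_all add: pauli_X_def pauli_Y_def pauli_Z_def mat_of_rows_list_def)

text \<open>Allows sums over the set to be expanded into four terms and fixes its cardinality, which
  enters the order of the group.\<close>

lemma single_paulis_distinct: "distinct [1\<^sub>m 2, pauli_X, pauli_Y, pauli_Z]"
proof -
  have neq: "A \<noteq> B" if "A $$ (0, 0) \<noteq> B $$ (0, 0) \<or> A $$ (Suc 0, Suc 0) \<noteq> B $$ (Suc 0, Suc 0)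
      \<or> A $$ (0, Suc 0) \<noteq> B $$ (0, Suc 0)" for A B :: "complex mat"
    using that by auto
  have "- \<i> \<noteq> 1" by (simp add: complex_eq_iff)
  then show ?thesis
    by (simp, intro conjI neq) (auto simp: complex_eq_iff)
qed

lemma unitary_single_paulis:
  assumes "s \<in> single_paulis"
  shows "unitary_op 2 s"
proof -
  have s: "s \<in> carrier_mat 2 2"
    using assms by (rule single_paulis_carrier)
  have entry: "(A * B) $$ (i, j) = A $$ (i, 0) * B $$ (0, j) + A $$ (i, Suc 0) * B $$ (Suc 0, j)"
    if "A \<in> carrier_mat 2 2" "B \<in> carrier_mat 2 2" "i < 2" "j < 2" for A B :: "complex mat" and i j
    unfolding index_mult_mat_sum[OF that] by (simp add: numeral_2_eq_2 lessThan_Suc)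
  have "cnj (s $$ (0, i)) * s $$ (0, j) + cnj (s $$ (Suc 0, i)) * s $$ (Suc 0, j) = (if i = j then 1 else 0)"
    if "i < 2" "j < 2" for i j
    using that assms by (auto simp: less_2_cases_iff)
  then have "(mat_adjoint s * s) $$ (i, j) = 1\<^sub>m 2 $$ (i, j)" if "i < 2" "j < 2" for i j
    using that s by (subst entry) simp_all
  then have "mat_adjoint s * s = 1\<^sub>m 2"
    using s by (intro eq_matI) simp_all
  moreover from this have "s * mat_adjoint s = 1\<^sub>m 2"
    using s by (intro mat_mult_left_right_inverse[of "mat_adjoint s"]) simp_all
  ultimately show ?thesis
    using s by (simp add: unitary_op_def)
qed

text \<open>The completeness relation: divided by the square root of 2, the four matrices form an
  orthonormal basis of the 2 by 2 matrices for the Hilbert-Schmidt inner product.\<close>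

lemma sum_single_paulis:
  assumes "a < 2" "b < 2" "c < 2" "d < 2"
  shows "(\<Sum>s\<in>single_paulis. s $$ (a, c) * cnj (s $$ (b, d))) = (if a = b \<and> c = d then 2 else 0)"
proof -
  have "(\<Sum>s\<in>single_paulis. g s) = g (1\<^sub>m 2) + g pauli_X + g pauli_Y + g pauli_Z" for g :: "_ \<Rightarrow> complex"
    using sum.distinct_set_conv_list[OF single_paulis_distinct, of g] by (simp add: add.assoc)
  then show ?thesis
    using assms by (auto simp: less_2_cases_iff)
qed

section \<open>The Pauli group by recursion on the number of qubits\<close>

lemma pauli_group_0: "pauli_group 0 = (\<lambda>k. \<i> ^ k \<cdot>\<^sub>m 1\<^sub>m 1) ` {..<4}"
  by (auto simp: pauli_group_def)

text \<open>A scalar may be attached to either factor of a Kronecker product. Pushing the phase into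
  the tail leaves a phase-free leading matrix, which makes induction on \<open>r\<close>
  possible.\<close>

lemma pauli_group_Suc:
  "pauli_group (Suc r) = (\<lambda>(s, U). kron s U) ` (single_paulis \<times> pauli_group r)"
proof (intro equalityI subsetI)
  fix U assume "U \<in> pauli_group (Suc r)"
  then obtain k xs where k: "k < 4" and xs: "length xs = Suc r" "set xs \<subseteq> single_paulis"
      and U: "U = \<i> ^ k \<cdot>\<^sub>m foldr kron xs (1\<^sub>m 1)"
    unfolding pauli_group_def by blast
  from xs(1) obtain s ss where "xs = s # ss" "length ss = r"
    by (auto simp: length_Suc_conv)
  then have ss: "length ss = r" "set ss \<subseteq> single_paulis" "s \<in> single_paulis"
    and U': "U = kron s (\<i> ^ k \<cdot>\<^sub>m foldr kron ss (1\<^sub>m 1))"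
    using xs(2) by (simp_all only: list.set insert_subset U kron_smult_right foldr.simps o_apply)
  have "\<i> ^ k \<cdot>\<^sub>m foldr kron ss (1\<^sub>m 1) \<in> pauli_group r"
    unfolding pauli_group_def using k ss by blast
  with ss(3) show "U \<in> (\<lambda>(s, U). kron s U) ` (single_paulis \<times> pauli_group r)"
    unfolding U' by (intro image_eqI[where x = "(s, \<i> ^ k \<cdot>\<^sub>m foldr kron ss (1\<^sub>m 1))"]) (simp_all only: split_conv mem_Sigma_iff simp_thms)
next
  fix U assume "U \<in> (\<lambda>(s, U). kron s U) ` (single_paulis \<times> pauli_group r)"
  then obtain s U' where s: "s \<in> single_paulis" and U': "U' \<in> pauli_group r" "U = kron s U'"
    by (force simp del: insert_iff)
  then obtain k ss where "k < 4" "length ss = r" "set ss \<subseteq> single_paulis"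
      "U' = \<i> ^ k \<cdot>\<^sub>m foldr kron ss (1\<^sub>m 1)"
    unfolding pauli_group_def by blast
  with s U'(2) show "U \<in> pauli_group (Suc r)"
    unfolding pauli_group_def
    by (intro CollectI exI[of _ k] exI[of _ "s # ss"]) (simp add: kron_smult_right del: insert_iff)
qed

lemma finite_pauli_group: "finite (pauli_group r)"
  by (induction r) (auto simp: pauli_group_0 pauli_group_Suc)

lemma pauli_group_nonempty: "pauli_group r \<noteq> {}"
  by (induction r) (auto simp: pauli_group_0 pauli_group_Suc lessThan_empty_iff)

lemma unitary_pauli_group: "U \<in> pauli_group r \<Longrightarrow> unitary_op (2 ^ r) U"
proof (induction r arbitrary: U)
  case 0
  then obtain k :: nat where U: "U = \<i> ^ k \<cdot>\<^sub>m 1\<^sub>m 1"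
    by (auto simp: pauli_group_0)
  have adj: "mat_adjoint U = cnj (\<i> ^ k) \<cdot>\<^sub>m 1\<^sub>m 1"
    by (rule eq_matI) (auto simp: U)
  have "cmod (\<i> ^ k) = 1"
    by (simp add: norm_power)
  then have "\<i> ^ k * cnj (\<i> ^ k) = 1"
    by (metis complex_norm_square of_real_1 one_power2)
  then have "(\<i> ^ k * cnj (\<i> ^ k)) \<cdot>\<^sub>m (1\<^sub>m 1 :: complex mat) = 1\<^sub>m 1"
    by (intro eq_matI) simp_all
  moreover have "(a \<cdot>\<^sub>m 1\<^sub>m 1) * (b \<cdot>\<^sub>m 1\<^sub>m 1) = (a * b) \<cdot>\<^sub>m 1\<^sub>m 1" for a b :: complex
    by (rule eq_matI) (auto simp: scalar_prod_def)
  ultimately show ?case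
    unfolding unitary_op_def adj unfolding U by (simp add: mult.commute)
next
  case (Suc r)
  then obtain s U' where "s \<in> single_paulis" "U' \<in> pauli_group r" "U = kron s U'"
    by (auto simp: pauli_group_Suc)
  with Suc.IH show ?case
    by (simp add: unitary_op_kron unitary_single_paulis)
qed

lemma pauli_group_carrier: "U \<in> pauli_group r \<Longrightarrow> U \<in> carrier_mat (2 ^ r) (2 ^ r)"
  using unitary_pauli_group by (auto simp: unitary_op_def)

text \<open>A Kronecker product determines its factors only up to reciprocal scalars. The leading
  factors carry no phase and no two of them are proportional, so no freedom is left; sums over the
  group therefore split over pairs without multiplicities.\<close>

lemma inj_on_kron_pauli: "inj_on (\<lambda>(s, U). kron s U) (single_paulis \<times> pauli_group r)"
proof (rule inj_onI, clarsimp simp del: insert_iff)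
  fix s U s' U'
  assume s: "s \<in> single_paulis" and s': "s' \<in> single_paulis"
    and U: "U \<in> pauli_group r" and U': "U' \<in> pauli_group r" and eq: "kron s U = kron s' U'"
  let ?d = "2 ^ r :: nat"
  note c = single_paulis_carrier[OF s] single_paulis_carrier[OF s']
    pauli_group_carrier[OF U] pauli_group_carrier[OF U']
  have entry: "s $$ (a, b) * U $$ (i, j) = s' $$ (a, b) * U' $$ (i, j)"
    if "a < 2" "b < 2" "i < ?d" "j < ?d" for a b i j
  proof -
    have lt: "a * ?d + i < 2 * ?d" "b * ?d + j < 2 * ?d"
      using that by (auto simp: less_2_cases_iff)
    have "kron s U $$ (a * ?d + i, b * ?d + j) = kron s' U' $$ (a * ?d + i, b * ?d + j)"
      by (simp add: eq)
    then show ?thesis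
      using lt that by (simp add: index_kron[OF c(1) c(3)] index_kron[OF c(2) c(4)])
  qed
  \<comment> \<open>A unitary has no zero row, so row 0 contains a nonzero pivot. Against it, the
    zero pattern separates the identity and \<open>pauli_Z\<close> from \<open>pauli_X\<close> and
    \<open>pauli_Y\<close>, and the relative sign of the two nonzero entries separates the members
    of each pair.\<close>
  have "\<exists>j<?d. U $$ (0, j) \<noteq> 0"
  proof (rule ccontr)
    assume "\<not> ?thesis"
    then have "(U * mat_adjoint U) $$ (0, 0) = 0"
      using c(3) by (subst index_mult_mat_sum[of _ ?d ?d _ ?d]) auto
    then show False
      using unitary_opD(4)[OF unitary_pauli_group[OF U]] by simp
  qed
  then obtain j where j: "j < ?d" "U $$ (0, j) \<noteq> 0" by blast
  have "s = s'"
    using entry[of 0 0 0 j] entry[of 0 1 0 j] entry[of 1 0 0 j] entry[of 1 1 0 j] j s s'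
    by auto
  moreover have "U = U'"
  proof (rule eq_matI)
    fix i j assume "i < dim_row U'" "j < dim_col U'"
    then have "i < ?d" "j < ?d" using c by auto
    then show "U $$ (i, j) = U' $$ (i, j)"
      using entry[of 0 0 i j] entry[of 0 1 i j] s s' \<open>s = s'\<close> by auto
  qed (use c in auto)
  ultimately show "s = s' \<and> U = U'" by simp
qed

text \<open>Entrywise form of the twirl: averaging \<open>U X U\<^sup>\<dagger>\<close> over the group yields \<open>(tr X / 2\<^sup>r) I\<close>.\<close>

lemma pauli_group_orthogonality:
  assumes "a < 2 ^ r" "b < 2 ^ r" "c < 2 ^ r" "d < 2 ^ r"
  shows "(\<Sum>U\<in>pauli_group r. U $$ (a, c) * cnj (U $$ (b, d))) =
    (if a = b \<and> c = d then of_nat (card (pauli_group r)) / 2 ^ r else 0)"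
  using assms
proof (induction r arbitrary: a b c d)
  case 0
  \<comment> \<open>Only phases are left for \<open>r = 0\<close>; each has modulus 1, so every
    summand is 1 and the sum is the order of the group.\<close>
  have "U $$ (0, 0) * cnj (U $$ (0, 0)) = 1" if U: "U \<in> pauli_group 0" for U
  proof -
    have "(U * mat_adjoint U) $$ (0, 0) = 1"
      using unitary_opD(4)[OF unitary_pauli_group[OF U]] by simp
    then show ?thesis
      using pauli_group_carrier[OF U] by (subst (asm) index_mult_mat_sum[of _ 1 1 _ 1]) auto
  qed
  with 0 show ?case by simp
next
  case (Suc r)
  let ?d = "2 ^ r :: nat"
  have lt: "x div ?d < 2" "x mod ?d < ?d" if "x < 2 ^ Suc r" for x
    using that by (auto simp: less_mult_imp_div_less)
  have eq_iff: "x = y \<longleftrightarrow> x div ?d = y div ?d \<and> x mod ?d = y mod ?d" for x y :: nat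
    by (metis div_mult_mod_eq)
  have card: "card (pauli_group (Suc r)) = 4 * card (pauli_group r)"
    using distinct_card[OF single_paulis_distinct]
    by (simp add: pauli_group_Suc card_image[OF inj_on_kron_pauli] card_cartesian_product)
  have kron_entry: "kron s U $$ (x, y) = s $$ (x div ?d, y div ?d) * U $$ (x mod ?d, y mod ?d)"
    if "s \<in> single_paulis" "U \<in> pauli_group r" "x < 2 ^ Suc r" "y < 2 ^ Suc r" for s U x y
    using that by (intro index_kron[OF single_paulis_carrier pauli_group_carrier]) auto
  have "(\<Sum>U\<in>pauli_group (Suc r). U $$ (a, c) * cnj (U $$ (b, d))) =
      (\<Sum>(s, U)\<in>single_paulis \<times> pauli_group r. kron s U $$ (a, c) * cnj (kron s U $$ (b, d)))"
    unfolding pauli_group_Suc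
    by (subst sum.reindex[OF inj_on_kron_pauli]) (simp add: case_prod_unfold)
  also have "\<dots> = (\<Sum>(s, U)\<in>single_paulis \<times> pauli_group r.
      (s $$ (a div ?d, c div ?d) * cnj (s $$ (b div ?d, d div ?d))) *
      (U $$ (a mod ?d, c mod ?d) * cnj (U $$ (b mod ?d, d mod ?d))))"
  proof (intro sum.cong refl)
    fix x assume "x \<in> single_paulis \<times> pauli_group r"
    then obtain s U where x: "x = (s, U)" and sU: "s \<in> single_paulis" "U \<in> pauli_group r"
      by blast
    show "(case x of (s, U) \<Rightarrow> kron s U $$ (a, c) * cnj (kron s U $$ (b, d))) =
        (case x of (s, U) \<Rightarrow> (s $$ (a div ?d, c div ?d) * cnj (s $$ (b div ?d, d div ?d))) *
          (U $$ (a mod ?d, c mod ?d) * cnj (U $$ (b mod ?d, d mod ?d))))"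
      unfolding x split_conv kron_entry[OF sU Suc.prems(1,3)] kron_entry[OF sU Suc.prems(2,4)]
      by simp
  qed
  also have "\<dots> = (\<Sum>s\<in>single_paulis. s $$ (a div ?d, c div ?d) * cnj (s $$ (b div ?d, d div ?d))) *
      (\<Sum>U\<in>pauli_group r. U $$ (a mod ?d, c mod ?d) * cnj (U $$ (b mod ?d, d mod ?d)))"
    by (simp only: sum_product sum.cartesian_product)
  also have "\<dots> = (if a div ?d = b div ?d \<and> c div ?d = d div ?d then 2 else 0) *
      (if a mod ?d = b mod ?d \<and> c mod ?d = d mod ?d then of_nat (card (pauli_group r)) / 2 ^ r else 0)"
    using Suc.prems by (subst sum_single_paulis Suc.IH; simp add: lt)+
  \<comment> \<open>The order grows by 4 and the dimension by 2, which matches the factor 2 of the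
    completeness relation. Two indices agree exactly when their leading and trailing components
    do.\<close>
  also have "\<dots> = (if a = b \<and> c = d then of_nat (card (pauli_group (Suc r))) / 2 ^ Suc r else 0)"
    unfolding card using eq_iff[of a b] eq_iff[of c d] by auto
  finally show ?case .
qed

subsection \<open>Block-diagonal operators and the Pauli twirl\<close>

lemma mat_sum_mult_vec:
  assumes "\<And>i. i \<in> I \<Longrightarrow> A i \<in> carrier_mat n n" "v \<in> carrier_vec n" "a < n"
  shows "vec_index (mat_sum n A I *\<^sub>v v) a = (\<Sum>i\<in>I. vec_index (A i *\<^sub>v v) a)"
proof -
  have "vec_index (mat_sum n A I *\<^sub>v v) a = (\<Sum>b<n. \<Sum>i\<in>I. A i $$ (a, b) * vec_index v b)"
    using assms(2,3) by (simp add: mat_sum_def scalar_prod_def atLeast0LessThan sum_distrib_right)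
  also have "\<dots> = (\<Sum>i\<in>I. \<Sum>b<n. A i $$ (a, b) * vec_index v b)"
    by (rule sum.swap)
  also have "\<dots> = (\<Sum>i\<in>I. vec_index (A i *\<^sub>v v) a)"
  proof (rule sum.cong)
    fix i assume "i \<in> I"
    then have "A i \<in> carrier_mat n n" by (rule assms(1))
    then show "(\<Sum>b<n. A i $$ (a, b) * vec_index v b) = vec_index (A i *\<^sub>v v) a"
      using assms(2,3) by (simp add: scalar_prod_def atLeast0LessThan)
  qed simp
  finally show ?thesis .
qed

lemma psd_mat_sum:
  assumes A: "\<And>i. i \<in> I \<Longrightarrow> A i \<in> carrier_mat n n" and v: "v \<in> carrier_vec n"
    and psd: "\<And>i. i \<in> I \<Longrightarrow> 0 \<le> Re ((A i *\<^sub>v v) \<bullet>c v)"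
  shows "0 \<le> Re ((mat_sum n A I *\<^sub>v v) \<bullet>c v)"
proof -
  have "(mat_sum n A I *\<^sub>v v) \<bullet>c v = (\<Sum>a<n. \<Sum>i\<in>I. vec_index (A i *\<^sub>v v) a * cnj (vec_index v a))"
    using v unfolding scalar_prod_def[of _ "conjugate v"]
    by (auto simp: mat_sum_mult_vec[OF A v] atLeast0LessThan sum_distrib_right simp del: index_mult_mat_vec
        intro!: sum.cong)
  also have "\<dots> = (\<Sum>i\<in>I. \<Sum>a<n. vec_index (A i *\<^sub>v v) a * cnj (vec_index v a))"
    by (rule sum.swap)
  also have "\<dots> = (\<Sum>i\<in>I. (A i *\<^sub>v v) \<bullet>c v)"
    using v unfolding scalar_prod_def[of _ "conjugate v"]
    by (auto simp: atLeast0LessThan simp del: index_mult_mat_vec intro!: sum.cong)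
  finally show ?thesis
    by (auto intro!: sum_nonneg psd)
qed

text \<open>The quadratic form of the conjugated operator at \<open>v\<close> is that of
  \<open>X\<close> at the adjoint of \<open>W\<close> applied to \<open>v\<close>.\<close>

lemma psd_conj:
  fixes W X :: "complex mat"
  assumes "W \<in> carrier_mat n n" "X \<in> carrier_mat n n" "v \<in> carrier_vec n"
    and psd: "\<And>w. w \<in> carrier_vec n \<Longrightarrow> 0 \<le> Re ((X *\<^sub>v w) \<bullet>c w)"
  shows "0 \<le> Re (((W * X * mat_adjoint W) *\<^sub>v v) \<bullet>c v)"
proof -
  have W': "mat_adjoint W \<in> carrier_mat n n" using assms(1) by simp
  have w: "mat_adjoint W *\<^sub>v v \<in> carrier_vec n"
    using W' assms(3) by (rule mult_mat_vec_carrier)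
  have "(W * X * mat_adjoint W) *\<^sub>v v = (W * X) *\<^sub>v (mat_adjoint W *\<^sub>v v)"
    by (rule assoc_mult_mat_vec[of _ n n _ n]) (use assms W' in auto)
  also have "\<dots> = W *\<^sub>v (X *\<^sub>v (mat_adjoint W *\<^sub>v v))"
    by (rule assoc_mult_mat_vec[of _ n n _ n]) (use assms w in auto)
  finally have "((W * X * mat_adjoint W) *\<^sub>v v) \<bullet>c v =
      (X *\<^sub>v (mat_adjoint W *\<^sub>v v)) \<bullet>c (mat_adjoint W *\<^sub>v v)"
    using mat_adjoint_mult_vec_scalar_prod[OF assms(1) mult_mat_vec_carrier[OF assms(2) w] assms(3)]
    by simp
  with psd[OF w] show ?thesis by simp
qed

text \<open>Passes from the Schroedinger to the Heisenberg picture: the outer rotation is moved from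
  the state to the observable, which then no longer depends on the sampled group element.\<close>

lemma mat_trace_mult_conj:
  fixes H Z X :: "complex mat"
  assumes "H \<in> carrier_mat n n" "Z \<in> carrier_mat n n" "X \<in> carrier_mat n n" "Y \<in> carrier_mat n n"
  shows "mat_trace (H * (Z * X * Y)) = mat_trace ((Y * H * Z) * X)"
proof -
  note [simp] = assms mult_carrier_mat[of _ n n _ n] assoc_mult_mat[of _ n n _ n _ n]
  have "mat_trace (H * (Z * X * Y)) = mat_trace ((H * Z * X) * Y)"
    by simp
  also have "\<dots> = mat_trace (Y * (H * Z * X))"
    by (rule mat_trace_comm[of _ n n]) auto
  finally show ?thesis by simp
qed

text \<open>The operator \<open>|i><i| \<otimes> 1\<close> in tensor coordinates. Being diagonal, it
  acts on a matrix by keeping or deleting whole rows and columns.\<close>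

definition block_projector :: "nat \<Rightarrow> nat \<Rightarrow> nat \<Rightarrow> complex mat" where
  "block_projector N d i = mat_diag N (\<lambda>x. if x div d = i then 1 else 0)"

lemma block_projector_carrier [simp]: "block_projector N d i \<in> carrier_mat N N"
  by (simp add: block_projector_def)

lemma kron_basis_projector:
  assumes "0 < d"
  shows "kron (basis_projector M i) (1\<^sub>m d) = block_projector (M * d) d i"
proof (rule eq_matI)
  fix x y assume "x < dim_row (block_projector (M * d) d i)" "y < dim_col (block_projector (M * d) d i)"
  then have xy: "x < M * d" "y < M * d" by (auto simp: block_projector_def mat_diag_def)
  then have lt: "x div d < M" "y div d < M" "x mod d < d" "y mod d < d"
    using assms by (auto simp: less_mult_imp_div_less)
  have eq: "x = y \<longleftrightarrow> x div d = y div d \<and> x mod d = y mod d"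
    by (metis div_mult_mod_eq)
  show "kron (basis_projector M i) (1\<^sub>m d) $$ (x, y) = block_projector (M * d) d i $$ (x, y)"
    using xy lt eq by (auto simp: kron_def basis_projector_def block_projector_def mat_diag_def)
qed (auto simp: kron_def basis_projector_def block_projector_def mat_diag_def)

text \<open>\<open>1 \<otimes> U\<close> is block diagonal with identical blocks, so a row meets
  only places in its own block. The free function \<open>h\<close> lets the same identity handle
  left multiplication and, after complex conjugation, right multiplication by the adjoint.\<close>

lemma kron_one_row_sum:
  assumes U: "U \<in> carrier_mat d d" and x: "x < M * d" and d: "0 < d"
  shows "(\<Sum>z<M * d. kron (1\<^sub>m M) U $$ (x, z) * h z) =
    (\<Sum>c<d. U $$ (x mod d, c) * h (x div d * d + c))"
proof -
  have xd: "x div d < M" using x by (simp add: less_mult_imp_div_less)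
  have "(\<Sum>z<M * d. kron (1\<^sub>m M) U $$ (x, z) * h z) =
      (\<Sum>z<M * d. (1\<^sub>m M $$ (x div d, z div d) * U $$ (x mod d, z mod d)) * h (z div d * d + z mod d))"
    using x U by (intro sum.cong) (auto simp: index_kron[of _ M M _ d d])
  also have "\<dots> = (\<Sum>a<M. \<Sum>c<d. (1\<^sub>m M $$ (x div d, a) * U $$ (x mod d, c)) * h (a * d + c))"
    by (rule sum_div_mod[OF d])
  also have "\<dots> = (\<Sum>a<M. if a = x div d then (\<Sum>c<d. U $$ (x mod d, c) * h (x div d * d + c)) else 0)"
    using xd by (intro sum.cong) auto
  finally show ?thesis
    using xd by simp
qed

lemma index_kron_one_conj:
  assumes U: "U \<in> carrier_mat d d" and B: "B \<in> carrier_mat (M * d) (M * d)"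
    and xy: "x < M * d" "y < M * d" and d: "0 < d"
  shows "(kron (1\<^sub>m M) U * B * mat_adjoint (kron (1\<^sub>m M) U)) $$ (x, y) =
    (\<Sum>c<d. \<Sum>e<d. B $$ (x div d * d + c, y div d * d + e) * (U $$ (x mod d, c) * cnj (U $$ (y mod d, e))))"
proof -
  let ?K = "kron (1\<^sub>m M) U"
  have K: "?K \<in> carrier_mat (M * d) (M * d)" using U by simp
  have blk: "x div d * d + c < M * d" if "c < d" for c
  proof -
    have "x div d * d + c < (x div d + 1) * d" using that by simp
    also have "\<dots> \<le> M * d"
      using xy(1) by (intro mult_right_mono) (auto simp: less_mult_imp_div_less Suc_le_eq)
    finally show ?thesis .
  qed
  have "?K * B * mat_adjoint ?K = ?K * (B * mat_adjoint ?K)"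
    using K B by (intro assoc_mult_mat) auto
  then have "(?K * B * mat_adjoint ?K) $$ (x, y) = (\<Sum>z<M * d. ?K $$ (x, z) * (B * mat_adjoint ?K) $$ (z, y))"
    using K B xy by (simp only:) (rule index_mult_mat_sum, auto)
  also have "\<dots> = (\<Sum>c<d. U $$ (x mod d, c) * (B * mat_adjoint ?K) $$ (x div d * d + c, y))"
    by (rule kron_one_row_sum[OF U xy(1) d])
  also have "\<dots> = (\<Sum>c<d. U $$ (x mod d, c) *
      (\<Sum>e<d. cnj (U $$ (y mod d, e)) * B $$ (x div d * d + c, y div d * d + e)))"
  proof (intro sum.cong refl arg_cong2[where f = "(*)"])
    fix c assume c: "c \<in> {..<d}"
    have "(B * mat_adjoint ?K) $$ (x div d * d + c, y) =
        (\<Sum>w<M * d. B $$ (x div d * d + c, w) * mat_adjoint ?K $$ (w, y))"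
      using K B xy blk[of c] c by (intro index_mult_mat_sum) auto
    \<comment> \<open>A column of the adjoint is a conjugated row, so conjugating the whole sum
      brings it into the shape of \<open>kron_one_row_sum\<close>.\<close>
    also have "\<dots> = cnj (\<Sum>w<M * d. ?K $$ (y, w) * cnj (B $$ (x div d * d + c, w)))"
      unfolding cnj_sum using K xy by (intro sum.cong) auto
    also have "\<dots> = (\<Sum>e<d. cnj (U $$ (y mod d, e)) * B $$ (x div d * d + c, y div d * d + e))"
      by (subst kron_one_row_sum[OF U xy(2) d]) simp
    finally show "(B * mat_adjoint ?K) $$ (x div d * d + c, y) = \<dots>" .
  qed
  finally show ?thesis
    by (simp add: sum_distrib_left mult_ac)
qed

text \<open>Orthogonality leaves only terms with equal inner summation indices, and only if
  \<open>x\<close> and \<open>y\<close> have the same place inside their blocks. If these blocks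
  differ, what is left is the trace of an off-diagonal block of \<open>B\<close>, and
  \<open>block\<close> makes it vanish. The identity is for the sum over the group, so the group
  order remains as a factor.\<close>

lemma pauli_twirl:
  assumes B: "B \<in> carrier_mat (M * 2 ^ r) (M * 2 ^ r)" and xy: "x < M * 2 ^ r" "y < M * 2 ^ r"
    and block: "\<And>z w. z < M * 2 ^ r \<Longrightarrow> w < M * 2 ^ r \<Longrightarrow> z div 2 ^ r \<noteq> w div 2 ^ r \<Longrightarrow> B $$ (z, w) = 0"
  shows "(\<Sum>U\<in>pauli_group r. (kron (1\<^sub>m M) U * B * mat_adjoint (kron (1\<^sub>m M) U)) $$ (x, y)) =
    (if x = y then of_nat (card (pauli_group r)) / 2 ^ r *
      (\<Sum>c<2 ^ r. B $$ (x div 2 ^ r * 2 ^ r + c, x div 2 ^ r * 2 ^ r + c)) else 0)"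
proof -
  define d :: nat where "d = 2 ^ r"
  define g :: complex where "g = of_nat (card (pauli_group r)) / 2 ^ r"
  have d: "0 < d" by (simp add: d_def)
  have blk: "z div d * d + c < M * d" if "c < d" "z < M * d" for c z
  proof -
    have "z div d * d + c < (z div d + 1) * d" using that by simp
    also have "\<dots> \<le> M * d"
      using that by (intro mult_right_mono) (auto simp: less_mult_imp_div_less Suc_le_eq)
    finally show ?thesis .
  qed
  have "(\<Sum>U\<in>pauli_group r. (kron (1\<^sub>m M) U * B * mat_adjoint (kron (1\<^sub>m M) U)) $$ (x, y)) =
      (\<Sum>U\<in>pauli_group r. \<Sum>c<d. \<Sum>e<d. B $$ (x div d * d + c, y div d * d + e) *
        (U $$ (x mod d, c) * cnj (U $$ (y mod d, e))))"
    using assms pauli_group_carrier d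
    by (intro sum.cong refl index_kron_one_conj) (auto simp: d_def)
  also have "\<dots> = (\<Sum>c<d. \<Sum>e<d. B $$ (x div d * d + c, y div d * d + e) *
      (\<Sum>U\<in>pauli_group r. U $$ (x mod d, c) * cnj (U $$ (y mod d, e))))"
    unfolding sum_distrib_left by (subst sum.swap, intro sum.cong refl, rule sum.swap)
  also have "\<dots> = (\<Sum>c<d. \<Sum>e<d. if e = c then
      (if x mod d = y mod d then g * B $$ (x div d * d + c, y div d * d + c) else 0) else 0)"
    by (intro sum.cong refl) (auto simp: pauli_group_orthogonality d_def g_def)
  also have "\<dots> = (\<Sum>c<d. if x mod d = y mod d then g * B $$ (x div d * d + c, y div d * d + c) else 0)"
    by simp
  also have "\<dots> = (if x = y then g * (\<Sum>c<d. B $$ (x div d * d + c, x div d * d + c)) else 0)"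
  proof (cases "x = y")
    case False
    then have "x mod d \<noteq> y mod d \<or> x div d \<noteq> y div d"
      by (metis div_mult_mod_eq)
    then have "(if x mod d = y mod d then g * B $$ (x div d * d + c, y div d * d + c) else 0) = 0"
      if "c < d" for c
      using block[folded d_def, OF blk[OF that xy(1)[folded d_def]] blk[OF that xy(2)[folded d_def]]] that d
      by auto
    with False show ?thesis by simp
  qed (simp add: sum_distrib_left)
  finally show ?thesis by (simp add: d_def g_def)
qed

subsection \<open>The minimal energy over a unitary orbit\<close>

text \<open>Abel summation as an induction: lowering the weight \<open>q n\<close> to
  \<open>q (Suc n)\<close> on a non-negative partial sum can only decrease the value. The weights
  may have any sign.\<close>

lemma antimono_weighted_sum_ge:
  fixes q x :: "nat \<Rightarrow> real"
  assumes "\<And>k l. k \<le> l \<Longrightarrow> l \<le> n \<Longrightarrow> q l \<le> q k" "\<And>m. m \<le> n \<Longrightarrow> 0 \<le> (\<Sum>k<m. x k)"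
  shows "q n * (\<Sum>k<Suc n. x k) \<le> (\<Sum>k<Suc n. q k * x k)"
  using assms
proof (induction n)
  case (Suc n)
  have "q (Suc n) * (\<Sum>k<Suc n. x k) \<le> q n * (\<Sum>k<Suc n. x k)"
    using Suc.prems(1)[of n "Suc n"] Suc.prems(2)[of "Suc n"] by (intro mult_right_mono) auto
  also have "\<dots> \<le> (\<Sum>k<Suc n. q k * x k)"
    using Suc.prems by (intro Suc.IH) auto
  finally show ?case
    by (simp add: algebra_simps)
qed simp

text \<open>Abel summation in \<open>q\<close> reduces the claim to the partial sums of
  \<open>x k = (\<Sum>l. E l * D l k) - E k\<close>; they are nonnegative because a total weight \<open>m\<close>
  spread over the indices with at most 1 on each has least energy on the \<open>m\<close> lowest ones. This
  avoids Birkhoff's theorem.\<close>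

lemma doubly_stochastic_rearrangement:
  fixes D :: "nat \<Rightarrow> nat \<Rightarrow> real" and E q :: "nat \<Rightarrow> real"
  assumes D: "\<And>l k. 0 \<le> D l k" and row: "\<And>l. l < N \<Longrightarrow> (\<Sum>k<N. D l k) = 1"
    and col: "\<And>k. k < N \<Longrightarrow> (\<Sum>l<N. D l k) = 1"
    and E: "\<And>k l. k \<le> l \<Longrightarrow> l < N \<Longrightarrow> E k \<le> E l"
    and q: "\<And>k l. k \<le> l \<Longrightarrow> l < N \<Longrightarrow> q l \<le> q k"
  shows "(\<Sum>k<N. E k * q k) \<le> (\<Sum>l<N. \<Sum>k<N. E l * q k * D l k)"
proof (cases N)
  case (Suc n)
  define x where "x k = (\<Sum>l<N. E l * D l k) - E k" for k
  \<comment> \<open>\<open>c m l\<close> is the weight that the first \<open>m\<close> columns place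
    on level \<open>l\<close>, minus the weight of the optimal placement, which fills the
    \<open>m\<close> lowest levels.\<close>
  define c where "c m l = (\<Sum>k<m. D l k) - (if l < m then 1 else 0)" for m l
  have partial: "(\<Sum>k<m. x k) = (\<Sum>l<N. E l * c m l)" if "m \<le> N" for m
  proof -
    have "(\<Sum>k<m. E k) = (\<Sum>l<N. E l * (if l < m then 1 else 0))"
      using that by (intro sum.mono_neutral_cong_left) auto
    moreover have "(\<Sum>k<m. \<Sum>l<N. E l * D l k) = (\<Sum>l<N. E l * (\<Sum>k<m. D l k))"
      by (subst sum.swap) (simp add: sum_distrib_left)
    ultimately show ?thesis
      by (simp add: x_def c_def sum_subtractf right_diff_distrib)
  qed
  have c_sum: "(\<Sum>l<N. c m l) = 0" if "m \<le> N" for m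
  proof -
    have "(\<Sum>l<N. (if l < m then 1 else 0)) = (\<Sum>l<m. 1 :: real)"
      using that by (intro sum.mono_neutral_cong_right) auto
    moreover have "(\<Sum>l<N. \<Sum>k<m. D l k) = (\<Sum>k<m. 1)"
      using that col by (subst sum.swap) (intro sum.cong, auto)
    ultimately show ?thesis
      by (simp add: c_def sum_subtractf)
  qed
  have nonneg: "0 \<le> (\<Sum>k<m. x k)" if m: "m \<le> N" for m
  proof (cases m)
    case (Suc m')
    \<comment> \<open>The excesses \<open>c m\<close> sum to 0, so all energies may be shifted by
      \<open>E m'\<close>, where \<open>m' = m - 1\<close> is the highest of the \<open>m\<close>
      lowest levels. After the shift both factors are non-positive below \<open>m\<close> and
      non-negative from \<open>m\<close> on.\<close>
    have "0 \<le> (E l - E m') * c m l" if l: "l < N" for l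
    proof (cases "l < m")
      case True
      have "(\<Sum>k<m. D l k) \<le> (\<Sum>k<N. D l k)"
        using m D by (intro sum_mono2) auto
      then have "c m l \<le> 0" using True row[OF l] by (simp add: c_def)
      moreover have "E l \<le> E m'" using E[of l m'] True m Suc by simp
      ultimately show ?thesis by (intro mult_nonpos_nonpos) auto
    next
      case False
      then have "0 \<le> c m l" using D by (simp add: c_def sum_nonneg)
      moreover have "E m' \<le> E l" using E[of m' l] False l Suc by simp
      ultimately show ?thesis by simp
    qed
    then have "0 \<le> (\<Sum>l<N. (E l - E m') * c m l)"
      by (intro sum_nonneg) auto
    also have "\<dots> = (\<Sum>k<m. x k) - E m' * (\<Sum>l<N. c m l)"
      by (simp add: partial[OF m] left_diff_distrib sum_subtractf sum_distrib_left)
    finally show ?thesis using c_sum[OF m] by simp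
  qed simp
  \<comment> \<open>With all columns included, each row is full and every excess is 0. The boundary
    term of the Abel summation thus vanishes whatever the sign of \<open>q n\<close>.\<close>
  have "(\<Sum>k<N. x k) = 0"
    unfolding partial[OF order_refl] using row by (intro sum.neutral) (auto simp: c_def)
  moreover have "q n * (\<Sum>k<Suc n. x k) \<le> (\<Sum>k<Suc n. q k * x k)"
    using q nonneg Suc by (intro antimono_weighted_sum_ge) auto
  ultimately have "0 \<le> (\<Sum>k<N. q k * x k)"
    using Suc by simp
  also have "\<dots> = (\<Sum>k<N. \<Sum>l<N. E l * q k * D l k) - (\<Sum>k<N. E k * q k)"
    by (simp add: x_def right_diff_distrib sum_subtractf sum_distrib_left mult_ac)
  also have "(\<Sum>k<N. \<Sum>l<N. E l * q k * D l k) = (\<Sum>l<N. \<Sum>k<N. E l * q k * D l k)"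
    by (rule sum.swap)
  finally show ?thesis by simp
qed simp

text \<open>Squared moduli of the entries of a unitary form a doubly stochastic matrix; the column
  sums come from the same fact for the adjoint.\<close>

lemma unitary_op_row_sum:
  assumes "unitary_op N S" "l < N"
  shows "(\<Sum>k<N. (cmod (S $$ (l, k)))\<^sup>2) = 1"
proof -
  note S = unitary_opD[OF assms(1)]
  have "complex_of_real (\<Sum>k<N. (cmod (S $$ (l, k)))\<^sup>2) = (\<Sum>k<N. S $$ (l, k) * mat_adjoint S $$ (k, l))"
    unfolding of_real_sum using S(1) assms(2)
    by (intro sum.cong) (auto simp: complex_norm_square simp del: of_real_power)
  also have "\<dots> = (S * mat_adjoint S) $$ (l, l)"
    using S(1,2) assms(2) by (subst index_mult_mat_sum[of _ N N _ N]) auto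
  also have "\<dots> = 1" using S(4) assms(2) by simp
  finally show ?thesis by (simp only: of_real_eq_1_iff)
qed

lemma unitary_op_col_sum:
  assumes "unitary_op N S" "k < N"
  shows "(\<Sum>l<N. (cmod (S $$ (l, k)))\<^sup>2) = 1"
  using unitary_op_row_sum[OF unitary_op_adjoint[OF assms(1)] assms(2)] unitary_opD(1)[OF assms(1)]
    assms(2) by simp

text \<open>\<open>S\<close> is \<open>U\<close> written from the eigenbasis of \<open>R\<close> to
  that of \<open>H\<close>. Its squared entries are transition probabilities, so the energy depends
  on \<open>U\<close> only through a doubly stochastic matrix.\<close>

lemma energy_in_eigenbases:
  fixes E q :: "nat \<Rightarrow> real"
  assumes H: "H \<in> carrier_mat N N" "orthonormal_basis N f"
      "\<And>k. k < N \<Longrightarrow> H *\<^sub>v f k = complex_of_real (E k) \<cdot>\<^sub>v f k"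
    and R: "R \<in> carrier_mat N N" "orthonormal_basis N e"
      "\<And>k. k < N \<Longrightarrow> R *\<^sub>v e k = complex_of_real (q k) \<cdot>\<^sub>v e k"
    and U: "unitary_op N U"
  defines "S \<equiv> mat_adjoint (basis_mat N f) * U * basis_mat N e"
  shows "unitary_op N S"
    and "Re (mat_trace (H * U * R * mat_adjoint U)) =
      (\<Sum>l<N. \<Sum>k<N. E l * q k * (cmod (S $$ (l, k)))\<^sup>2)"
proof -
  define F where "F = basis_mat N f"
  define G where "G = basis_mat N e"
  define X where "X = U * R * mat_adjoint U"
  define Dq where "Dq = mat_diag N (\<lambda>k. complex_of_real (q k))"
  have uF: "unitary_op N F" and uG: "unitary_op N G"
    using H(2) R(2) by (simp_all add: F_def G_def unitary_basis_mat)
  show uS: "unitary_op N S"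
    unfolding S_def F_def[symmetric] G_def[symmetric]
    by (intro unitary_op_mult unitary_op_adjoint uF uG U)
  note [simp] = unitary_opD(1,2)[OF uF] unitary_opD(1,2)[OF uG] unitary_opD(1,2)[OF U] H(1) R(1)
    mult_carrier_mat[of _ N N _ N] assoc_mult_mat[of _ N N _ N _ N]
  have Dq[simp]: "Dq \<in> carrier_mat N N" by (simp add: Dq_def)
  have R_eq: "R = G * Dq * mat_adjoint G"
    unfolding G_def Dq_def by (rule diagonalization[OF R])
  have H_eq: "H = F * mat_diag N (\<lambda>k. complex_of_real (E k)) * mat_adjoint F"
    unfolding F_def by (rule diagonalization[OF H])
  have S_adj: "mat_adjoint S = mat_adjoint G * (mat_adjoint U * F)"
    by (simp add: S_def F_def[symmetric] G_def[symmetric] mat_adjoint_mult[of _ N N _ N])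
  have S_eq: "S = mat_adjoint F * (U * G)"
    by (simp add: S_def F_def G_def)
  have conj: "mat_adjoint F * X * F = S * (Dq * mat_adjoint S)"
    unfolding S_adj by (simp add: X_def R_eq S_eq)
  have entry: "(mat_adjoint F * X * F) $$ (l, l) = (\<Sum>k<N. complex_of_real (q k * (cmod (S $$ (l, k)))\<^sup>2))"
    if "l < N" for l
  proof -
    have S: "S \<in> carrier_mat N N" "mat_adjoint S \<in> carrier_mat N N"
      using unitary_opD[OF uS] by auto
    have "(S * (Dq * mat_adjoint S)) $$ (l, l) = (\<Sum>k<N. S $$ (l, k) * (q k * cnj (S $$ (l, k))))"
      using S that
      by (subst index_mult_mat_sum[of _ N N _ N]) (auto simp: Dq_def mat_diag_mult_left[of _ N N])
    then show ?thesis
      unfolding conj by (simp add: complex_norm_square mult_ac del: of_real_power)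
  qed
  have "mat_trace (H * U * R * mat_adjoint U) = mat_trace (H * X)"
    by (simp add: X_def)
  also have "\<dots> = mat_trace (X * H)"
    by (rule mat_trace_comm[of _ N N]) (simp_all add: X_def)
  also have "\<dots> = (\<Sum>l<N. complex_of_real (E l) * (mat_adjoint F * X * F) $$ (l, l))"
    by (subst H_eq, rule mat_trace_mult_diag_conj) (simp_all add: X_def)
  also have "\<dots> = complex_of_real (\<Sum>l<N. \<Sum>k<N. E l * q k * (cmod (S $$ (l, k)))\<^sup>2)"
    using entry by (simp add: sum_distrib_left mult.assoc)
  finally show "Re (mat_trace (H * U * R * mat_adjoint U)) =
      (\<Sum>l<N. \<Sum>k<N. E l * q k * (cmod (S $$ (l, k)))\<^sup>2)"
    by (simp only: Re_complex_of_real)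
qed

text \<open>A unitary carrying one sorted eigenbasis to the other has \<open>S = 1\<close> and pairs
  the largest weights with the lowest energies; the rearrangement inequality bounds all other
  unitaries from below. The minimum is thus attained by an explicit witness, without a compactness
  argument.\<close>

lemma Least_energy_eq:
  fixes E q :: "nat \<Rightarrow> real"
  assumes H: "H \<in> carrier_mat N N" "orthonormal_basis N f"
      "\<And>k. k < N \<Longrightarrow> H *\<^sub>v f k = complex_of_real (E k) \<cdot>\<^sub>v f k"
    and R: "R \<in> carrier_mat N N" "orthonormal_basis N e"
      "\<And>k. k < N \<Longrightarrow> R *\<^sub>v e k = complex_of_real (q k) \<cdot>\<^sub>v e k"
    and E: "\<And>k l. k \<le> l \<Longrightarrow> l < N \<Longrightarrow> E k \<le> E l"
    and q: "\<And>k l. k \<le> l \<Longrightarrow> l < N \<Longrightarrow> q l \<le> q k"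
    and U: "unitary_op N U" "\<And>k. k < N \<Longrightarrow> U *\<^sub>v e k = f k"
  shows "(LEAST x. \<exists>V. unitary_op N V \<and> x = Re (mat_trace (H * V * R * mat_adjoint V))) =
    Re (mat_trace (H * U * R * mat_adjoint U))"
proof (rule Least_equality)
  show "\<exists>V. unitary_op N V \<and>
      Re (mat_trace (H * U * R * mat_adjoint U)) = Re (mat_trace (H * V * R * mat_adjoint V))"
    using U(1) by blast
next
  fix y assume "\<exists>V. unitary_op N V \<and> y = Re (mat_trace (H * V * R * mat_adjoint V))"
  then obtain V where V: "unitary_op N V" and y: "y = Re (mat_trace (H * V * R * mat_adjoint V))"
    by blast
  note f = unitary_opD[OF unitary_basis_mat[OF H(2)]]
  define S where "S W = mat_adjoint (basis_mat N f) * W * basis_mat N e" for W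
  have energy: "Re (mat_trace (H * W * R * mat_adjoint W)) =
      (\<Sum>l<N. \<Sum>k<N. E l * q k * (cmod (S W $$ (l, k)))\<^sup>2)"
    and uS: "unitary_op N (S W)" if "unitary_op N W" for W
    unfolding S_def
    by (rule energy_in_eigenbases[OF H(1,2) _ R(1,2) _ that, where E = E and q = q];
        simp add: H(3) R(3))+
  have "U * basis_mat N e = basis_mat N f"
  proof (rule eq_matI)
    fix i k assume "i < dim_row (basis_mat N f)" "k < dim_col (basis_mat N f)"
    then have ik: "i < N" "k < N" by (auto simp: basis_mat_def)
    then have "(U * basis_mat N e) $$ (i, k) = vec_index (col (U * basis_mat N e) k) i"
      using unitary_opD(1)[OF U(1)] by (auto simp: basis_mat_def)
    also have "col (U * basis_mat N e) k = U *\<^sub>v col (basis_mat N e) k"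
      using unitary_opD(1)[OF U(1)] ik by (intro col_mult2) auto
    also have "\<dots> = f k"
      using ik U(2) by (simp add: col_basis_mat[OF R(2)])
    finally show "(U * basis_mat N e) $$ (i, k) = basis_mat N f $$ (i, k)"
      using ik by (simp add: basis_mat_def)
  qed (use unitary_opD(1)[OF U(1)] in \<open>auto simp: basis_mat_def\<close>)
  then have S1: "S U = 1\<^sub>m N"
    unfolding S_def using f unitary_opD(1)[OF U(1)] by (simp add: assoc_mult_mat[of _ N N _ N _ N])
  have "Re (mat_trace (H * U * R * mat_adjoint U)) =
      (\<Sum>l<N. \<Sum>k<N. E l * q k * (cmod ((1\<^sub>m N :: complex mat) $$ (l, k)))\<^sup>2)"
    using energy[OF U(1)] by (simp only: S1)
  also have "\<dots> = (\<Sum>l<N. \<Sum>k<N. if k = l then E l * q l else 0)"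
    by (intro sum.cong) auto
  also have "\<dots> = (\<Sum>l<N. E l * q l)"
    by simp
  also have "\<dots> \<le> y"
    unfolding y energy[OF V]
    by (rule doubly_stochastic_rearrangement)
       (use unitary_op_row_sum[OF uS[OF V]] unitary_op_col_sum[OF uS[OF V]] E q in auto)
  finally show "Re (mat_trace (H * U * R * mat_adjoint U)) \<le> y" .
qed

subsection \<open>Concentration of the rescaled mean\<close>

text \<open>An error \<open>\<epsilon>\<close> in twice the mean is an error
  \<open>\<epsilon> / 2\<close> in the mean, and the outcomes range over an interval of width
  \<open>2 * h\<close>. Hoeffding's exponent \<open>2 * T * (\<epsilon> / 2)^2 / (2 * h)^2\<close>
  is then \<open>T * \<epsilon>^2 / (8 * h^2)\<close>, the origin of the constant 8.\<close>

lemma Hoeffding_scaled_mean: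
  fixes p :: "real pmf" and h \<epsilon> :: real
  assumes h: "0 < h" and bd: "set_pmf p \<subseteq> {-h..h}" and T: "1 \<le> T" and eps: "0 < \<epsilon>"
  shows "measure_pmf.prob (map_pmf (\<lambda>\<mu>. 2 / real T * (\<Sum>j=1..T. \<mu> j)) (Pi_pmf {1..T} 0 (\<lambda>_. p)))
      {x. \<bar>x - 2 * measure_pmf.expectation p (\<lambda>x. x)\<bar> \<le> \<epsilon>}
    \<ge> 1 - 2 * exp (- (real T * \<epsilon>\<^sup>2 / (8 * h\<^sup>2)))"
proof -
  define Q where "Q = Pi_pmf {1..T} (0::real) (\<lambda>_. p)"
  define m where "m = measure_pmf.expectation p (\<lambda>x. x)"
  have comp: "map_pmf (\<lambda>f. f j) Q = p" if "j \<in> {1..T}" for j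
    using that by (simp add: Q_def Pi_pmf_component)
  have distr: "distr (measure_pmf Q) borel (\<lambda>f. f j) = distr (measure_pmf p) borel (\<lambda>x. x)"
    if "j \<in> {1..T}" for j
    by (subst comp[OF that, symmetric], unfold map_pmf_rep_eq, subst distr_distr) (auto simp: o_def)
  \<comment> \<open>Coordinate 1 represents the common distribution; it belongs to the index set
    because \<open>T\<close> is at least 1.\<close>
  interpret Hoeffding_ineq_iid Q "{1..T}" "\<lambda>j f. f j" "\<lambda>f. f 1" "-h" h m
  proof unfold_locales
    show "prob_space.indep_vars (measure_pmf Q) (\<lambda>_. borel) (\<lambda>j f. f j) {1..T}"
      unfolding Q_def
      by (intro prob_space.indep_vars_compose2[OF _ indep_vars_Pi_pmf, where Y = "\<lambda>_ x. x"])
         (auto simp: measure_pmf.prob_space_axioms)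
    show "distr (measure_pmf Q) borel (\<lambda>f. f j) = distr (measure_pmf Q) borel (\<lambda>f. f 1)"
      if "j \<in> {1..T}" for j
      using distr[OF that] distr[of 1] T by simp
    have "set_pmf (map_pmf (\<lambda>f. f 1) Q) \<subseteq> {-h..h}"
      using comp[of 1] T bd by simp
    then show "AE f in measure_pmf Q. f 1 \<in> {-h..h}"
      by (auto simp: AE_measure_pmf_iff)
    have "measure_pmf.expectation (map_pmf (\<lambda>f. f 1) Q) (\<lambda>x. x) = m"
      using comp[of 1] T by (simp add: m_def)
    then show "m \<equiv> measure_pmf.expectation Q (\<lambda>f. f 1)"
      by simp
  qed auto
  let ?B = "{f. \<bar>(\<Sum>j=1..T. f j) / real T - m\<bar> \<ge> \<epsilon> / 2}"
  have "measure_pmf.prob Q ?B \<le> 2 * exp (- 2 * real T * (\<epsilon> / 2)\<^sup>2 / (h - - h)\<^sup>2)"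
    using Hoeffding_ineq_abs_ge'[of "\<epsilon> / 2"] h T eps by simp
  also have "- 2 * real T * (\<epsilon> / 2)\<^sup>2 / (h - - h)\<^sup>2 = - (real T * \<epsilon>\<^sup>2 / (8 * h\<^sup>2))"
    using h by (simp add: power2_eq_square field_simps)
  finally have B: "measure_pmf.prob Q ?B \<le> 2 * exp (- (real T * \<epsilon>\<^sup>2 / (8 * h\<^sup>2)))" .
  have "- ?B \<subseteq> {f. \<bar>2 / real T * (\<Sum>j=1..T. f j) - 2 * m\<bar> \<le> \<epsilon>}"
  proof
    fix f assume "f \<in> - ?B"
    then have "\<bar>(\<Sum>j=1..T. f j) / real T - m\<bar> < \<epsilon> / 2" by auto
    moreover have "2 / real T * (\<Sum>j=1..T. f j) - 2 * m = 2 * ((\<Sum>j=1..T. f j) / real T - m)"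
      by (simp add: algebra_simps)
    moreover have "\<bar>2 * d\<bar> \<le> \<epsilon>" if "\<bar>d\<bar> < \<epsilon> / 2" for d :: real
      using that by (simp add: abs_mult)
    ultimately show "f \<in> {f. \<bar>2 / real T * (\<Sum>j=1..T. f j) - 2 * m\<bar> \<le> \<epsilon>}"
      by (simp only: mem_Collect_eq)
  qed
  then have "measure_pmf.prob Q (- ?B) \<le>
      measure_pmf.prob Q {f. \<bar>2 / real T * (\<Sum>j=1..T. f j) - 2 * m\<bar> \<le> \<epsilon>}"
    by (intro measure_pmf.finite_measure_mono) auto
  moreover have "measure_pmf.prob Q (- ?B) = 1 - measure_pmf.prob Q ?B"
    using measure_pmf.prob_compl[of ?B Q] by (simp add: Compl_eq_Diff_UNIV)
  ultimately show ?thesis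
    using B by (simp add: Q_def m_def vimage_def)
qed

subsection \<open>The work-extraction protocol\<close>

context
  fixes n r N M :: nat and H :: "complex mat" and P :: "nat \<Rightarrow> complex mat"
    and \<rho> V Ugl :: "complex mat"
  assumes r_le: "r \<le> n" and N_def: "N = 2 ^ n" and M_def: "M = 2 ^ (n - r)"
    and H: "hermitian_op N H" and P: "projective_measurement N M r P"
    and \<rho>: "density_op N \<rho>" and V: "tensor_identification N M r P V"
    and Ugl: "global_unitary N M r H P \<rho> Ugl"
begin

lemma N_eq: "N = M * 2 ^ r"
  using r_le by (simp add: N_def M_def flip: power_add)

lemma H_carrier: "H \<in> carrier_mat N N"
  using H by (simp add: hermitian_op_def)

lemma \<rho>_carrier: "\<rho> \<in> carrier_mat N N"
  using \<rho> by (simp add: density_op_def hermitian_op_def)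

lemma \<rho>_psd: "v \<in> carrier_vec N \<Longrightarrow> 0 \<le> Re ((\<rho> *\<^sub>v v) \<bullet>c v)"
  using \<rho> by (simp add: density_op_def)

lemma unitary_V: "unitary_op N V"
  using V by (simp add: tensor_identification_def)

lemma unitary_Ugl: "unitary_op N Ugl"
  using Ugl by (simp add: global_unitary_def)

lemma P_props:
  assumes "i < M"
  shows "P i \<in> carrier_mat N N" "mat_adjoint (P i) = P i" "P i * P i = P i"
  using P assms by (auto simp: projective_measurement_def projector_def hermitian_op_def)

lemma P_orth: "i < M \<Longrightarrow> j < M \<Longrightarrow> i \<noteq> j \<Longrightarrow> P i * P j = 0\<^sub>m N N"
  using P by (auto simp: projective_measurement_def)

lemma P_eq: "i < M \<Longrightarrow> P i = V * block_projector N (2 ^ r) i * mat_adjoint V"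
  using V by (simp add: tensor_identification_def kron_basis_projector N_eq)

lemma div_less_M: "k < N \<Longrightarrow> k div 2 ^ r < M"
  by (simp add: N_eq less_mult_imp_div_less)

section \<open>The states that occur in the protocol\<close>

abbreviation "measured \<equiv> post_measurement N M P \<rho>"
abbreviation "coarse \<equiv> coarse_grained N M r P \<rho>"

lemma measured_carrier: "measured \<in> carrier_mat N N"
  by (simp add: post_measurement_def)

lemma coarse_carrier: "coarse \<in> carrier_mat N N"
  by (simp add: coarse_grained_def)

lemma measured_trace: "mat_trace measured = 1"
proof -
  have c: "P i * \<rho> \<in> carrier_mat N N" "P i * \<rho> * P i \<in> carrier_mat N N" if "i < M" for i
    using P_props(1)[OF that] \<rho>_carrier by (auto intro!: mult_carrier_mat[of _ N N])
  have "mat_trace (P i * \<rho> * P i) = mat_trace (P i * \<rho>)" if i: "i < M" for i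
  proof -
    have "mat_trace (P i * \<rho> * P i) = mat_trace (P i * (P i * \<rho>))"
      by (rule mat_trace_comm[OF c(1)[OF i] P_props(1)[OF i]])
    also have "P i * (P i * \<rho>) = P i * P i * \<rho>"
      using P_props(1)[OF i] \<rho>_carrier by (simp add: assoc_mult_mat[of _ N N _ N _ N])
    finally show ?thesis using P_props(3)[OF i] by simp
  qed
  then have "mat_trace measured = (\<Sum>i<M. mat_trace (P i * \<rho>))"
    unfolding post_measurement_def using c(2) by (subst mat_trace_mat_sum) auto
  also have "\<dots> = mat_trace (mat_sum N (\<lambda>i. P i * \<rho>) {..<M})"
    using c(1) by (subst mat_trace_mat_sum) auto
  also have "mat_sum N (\<lambda>i. P i * \<rho>) {..<M} = mat_sum N P {..<M} * \<rho>"
    using P_props(1) \<rho>_carrier by (intro mat_sum_mult_right[symmetric]) auto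
  also have "\<dots> = \<rho>"
    using P \<rho>_carrier by (simp add: projective_measurement_def)
  finally show ?thesis
    using \<rho> by (simp add: density_op_def)
qed

lemma measured_psd:
  assumes v: "v \<in> carrier_vec N"
  shows "0 \<le> Re ((measured *\<^sub>v v) \<bullet>c v)"
  unfolding post_measurement_def
proof (rule psd_mat_sum[OF _ v])
  fix i assume "i \<in> {..<M}"
  then have i: "i < M" by simp
  show "P i * \<rho> * P i \<in> carrier_mat N N"
    using P_props(1)[OF i] \<rho>_carrier by (auto intro!: mult_carrier_mat[of _ N N])
  show "0 \<le> Re (((P i * \<rho> * P i) *\<^sub>v v) \<bullet>c v)"
    using psd_conj[OF P_props(1)[OF i] \<rho>_carrier v \<rho>_psd] P_props(2)[OF i] by simp
qed

text \<open>The energy is measured for each sampled \<open>U\<close> separately, before any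
  averaging, so each rotated operator must itself be a state. Conjugation by the unitary
  \<open>W\<close> preserves positivity and trace.\<close>

lemma rotated_state_density:
  assumes "U \<in> pauli_group r"
  defines "\<sigma> \<equiv> rotated_state N M P V Ugl \<rho> U"
  shows "\<sigma> \<in> carrier_mat N N" "\<And>v. v \<in> carrier_vec N \<Longrightarrow> 0 \<le> Re ((\<sigma> *\<^sub>v v) \<bullet>c v)" "mat_trace \<sigma> = 1"
proof -
  define W where "W = Ugl * (V * kron (1\<^sub>m M) U * mat_adjoint V)"
  have "unitary_op N (kron (1\<^sub>m M) U)"
    unfolding N_eq using unitary_op_one unitary_pauli_group[OF assms(1)]
    by (intro unitary_op_kron) auto
  then have uW: "unitary_op N W"
    unfolding W_def by (intro unitary_op_mult unitary_op_adjoint unitary_V unitary_Ugl)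
  note W = unitary_opD[OF uW]
  have \<sigma>: "\<sigma> = W * measured * mat_adjoint W"
    by (simp add: \<sigma>_def rotated_state_def W_def Let_def)
  show "\<sigma> \<in> carrier_mat N N"
    unfolding \<sigma> using W measured_carrier by (auto intro!: mult_carrier_mat[of _ N N])
  show "mat_trace \<sigma> = 1"
    using mat_trace_unitary_conj[OF unitary_op_adjoint[OF uW] measured_carrier] measured_trace by (simp add: \<sigma>)
  show "0 \<le> Re ((\<sigma> *\<^sub>v v) \<bullet>c v)" if "v \<in> carrier_vec N" for v
    unfolding \<sigma> by (rule psd_conj[OF W(1) measured_carrier that measured_psd])
qed

section \<open>Passage to tensor coordinates\<close>

abbreviation "tensor_state \<equiv> mat_adjoint V * \<rho> * V"

lemma tensor_state_carrier: "tensor_state \<in> carrier_mat N N"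
  using unitary_opD[OF unitary_V] \<rho>_carrier by (auto intro!: mult_carrier_mat[of _ N N])

lemma outcome_prob_eq:
  assumes "i < M"
  shows "complex_of_real (outcome_prob P \<rho> i) = (\<Sum>c<2 ^ r. tensor_state $$ (i * 2 ^ r + c, i * 2 ^ r + c))"
proof -
  note V' = unitary_opD[OF unitary_V]
  have "mat_adjoint tensor_state = tensor_state"
    using V' \<rho> by (simp add: density_op_def hermitian_op_def mat_adjoint_mult[of _ N N _ N]
      mult_carrier_mat[of _ N N _ N] assoc_mult_mat[of _ N N _ N _ N])
  moreover have "mat_adjoint tensor_state $$ (k, k) = cnj (tensor_state $$ (k, k))" if "k < N" for k
    using tensor_state_carrier that by (intro index_mat_adjoint) (simp_all only: carrier_matD)
  ultimately have "cnj (tensor_state $$ (k, k)) = tensor_state $$ (k, k)" if "k < N" for k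
    using that by metis
  then have real: "complex_of_real (Re (tensor_state $$ (k, k))) = tensor_state $$ (k, k)" if "k < N" for k
    using that by (simp add: complex_eq_iff)
  have "mat_trace (P i * \<rho>) = mat_trace (\<rho> * P i)"
    by (rule mat_trace_comm[OF P_props(1)[OF assms] \<rho>_carrier])
  also have "\<dots> = (\<Sum>k<N. (if k div 2 ^ r = i then 1 else 0) * tensor_state $$ (k, k))"
    unfolding P_eq[OF assms] block_projector_def
    by (rule mat_trace_mult_diag_conj[OF \<rho>_carrier V'(1,2)])
  finally have tr: "mat_trace (P i * \<rho>) = (\<Sum>k<N. (if k div 2 ^ r = i then 1 else 0) * tensor_state $$ (k, k))" .
  have "complex_of_real (outcome_prob P \<rho> i) = (\<Sum>k<N. (if k div 2 ^ r = i then 1 else 0) * tensor_state $$ (k, k))"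
    unfolding outcome_prob_def tr Re_sum of_real_sum
    by (intro sum.cong refl) (auto simp: real)
  also have "\<dots> = (\<Sum>k<M * 2 ^ r. (if k div 2 ^ r = i then 1 else 0) *
      tensor_state $$ (k div 2 ^ r * 2 ^ r + k mod 2 ^ r, k div 2 ^ r * 2 ^ r + k mod 2 ^ r))"
    by (simp only: N_eq div_mult_mod_eq)
  also have "\<dots> = (\<Sum>a<M. \<Sum>c<2 ^ r. (if a = i then 1 else 0) * tensor_state $$ (a * 2 ^ r + c, a * 2 ^ r + c))"
    by (rule sum_div_mod) simp
  also have "\<dots> = (\<Sum>a<M. if a = i then \<Sum>c<2 ^ r. tensor_state $$ (i * 2 ^ r + c, i * 2 ^ r + c) else 0)"
    by (intro sum.cong) auto
  finally show ?thesis
    using assms by simp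
qed

abbreviation "tensor_measured \<equiv> mat_adjoint V * measured * V"

lemma tensor_measured_carrier: "tensor_measured \<in> carrier_mat N N"
  using unitary_opD[OF unitary_V] measured_carrier by (auto intro!: mult_carrier_mat[of _ N N])

text \<open>In tensor coordinates each \<open>P i\<close> selects one block on both sides, so an
  entry survives only if its row and column share a block. This gives the vanishing required by
  \<open>pauli_twirl\<close> and identifies the block traces with those in
  \<open>outcome_prob_eq\<close>.\<close>

lemma index_tensor_measured:
  assumes "x < N" "y < N"
  shows "tensor_measured $$ (x, y) = (if x div 2 ^ r = y div 2 ^ r then tensor_state $$ (x, y) else 0)"
proof -
  note V' = unitary_opD[OF unitary_V]
  note [simp] = V'(1,2) \<rho>_carrier mult_carrier_mat[of _ N N _ N] assoc_mult_mat[of _ N N _ N _ N]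
    block_projector_carrier[of N]
  have blk: "mat_adjoint V * (P i * \<rho> * P i) * V =
      block_projector N (2 ^ r) i * tensor_state * block_projector N (2 ^ r) i" if "i < M" for i
    using V'(3) by (simp add: P_eq[OF that] mat_mult_cancel_left[of _ N _ _ N] right_mult_one_mat[of _ N N])
  have car: "P i * \<rho> * P i \<in> carrier_mat N N" if "i < M" for i
    using P_props(1)[OF that] by simp
  have "tensor_measured = mat_sum N (\<lambda>i. mat_adjoint V * (P i * \<rho> * P i) * V) {..<M}"
    unfolding post_measurement_def using car
    by (subst mat_sum_mult_left[of _ N], simp, simp, subst mat_sum_mult_right[of _ N])
       (auto simp del: assoc_mult_mat)
  also have "\<dots> = mat_sum N (\<lambda>i. block_projector N (2 ^ r) i * tensor_state * block_projector N (2 ^ r) i) {..<M}"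
    using blk by (intro mat_sum_cong) simp
  finally have "tensor_measured $$ (x, y) = (\<Sum>i<M. (block_projector N (2 ^ r) i * tensor_state * block_projector N (2 ^ r) i) $$ (x, y))"
    using assms by simp
  also have "\<dots> = (\<Sum>i<M. if i = x div 2 ^ r then (if x div 2 ^ r = y div 2 ^ r then tensor_state $$ (x, y) else 0) else 0)"
  proof (intro sum.cong refl)
    fix i
    have "block_projector N (2 ^ r) i * tensor_state =
        Matrix.mat N N (\<lambda>(a, b). (if a div 2 ^ r = i then 1 else 0) * tensor_state $$ (a, b))"
      unfolding block_projector_def by (rule mat_diag_mult_left[OF tensor_state_carrier])
    then have "block_projector N (2 ^ r) i * tensor_state * block_projector N (2 ^ r) i =
        Matrix.mat N N (\<lambda>(a, b). (Matrix.mat N N (\<lambda>(a, b). (if a div 2 ^ r = i then 1 else 0) * tensor_state $$ (a, b))) $$ (a, b)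
          * (if b div 2 ^ r = i then 1 else 0))"
      by (simp only: block_projector_def mat_diag_mult_right[OF mat_carrier])
    then show "(block_projector N (2 ^ r) i * tensor_state * block_projector N (2 ^ r) i) $$ (x, y) =
        (if i = x div 2 ^ r then (if x div 2 ^ r = y div 2 ^ r then tensor_state $$ (x, y) else 0) else 0)"
      using assms by (auto simp del: assoc_mult_mat)
  qed
  also have "\<dots> = (if x div 2 ^ r = y div 2 ^ r then tensor_state $$ (x, y) else 0)"
    using div_less_M[OF assms(1)] by simp
  finally show ?thesis .
qed

abbreviation "block_weight i \<equiv> complex_of_real (outcome_prob P \<rho> i / 2 ^ r)"

text \<open>A diagonal constant on blocks is also what the twirl produces, so the two states can be
  compared entry by entry.\<close>

lemma coarse_eq: "coarse = V * mat_diag N (\<lambda>x. block_weight (x div 2 ^ r)) * mat_adjoint V"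
proof -
  note V' = unitary_opD[OF unitary_V]
  have "coarse = mat_sum N (\<lambda>i. V * (block_weight i \<cdot>\<^sub>m block_projector N (2 ^ r) i) * mat_adjoint V) {..<M}"
    unfolding coarse_grained_def using V'
    by (intro mat_sum_cong)
       (auto simp: P_eq mult_smult_assoc_mat[of _ N N _ N] mult_smult_distrib[of _ N N _ N]
         mult_carrier_mat[of _ N N _ N])
  also have "\<dots> = V * mat_sum N (\<lambda>i. block_weight i \<cdot>\<^sub>m block_projector N (2 ^ r) i) {..<M} * mat_adjoint V"
    using V' by (subst mat_sum_mult_left[of _ N]; simp?; subst mat_sum_mult_right[of _ N])
      (auto simp: mult_carrier_mat[of _ N N _ N])
  also have "mat_sum N (\<lambda>i. block_weight i \<cdot>\<^sub>m block_projector N (2 ^ r) i) {..<M} =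
      mat_diag N (\<lambda>x. block_weight (x div 2 ^ r))"
  proof (rule eq_matI)
    fix x y assume "x < dim_row (mat_diag N (\<lambda>x. block_weight (x div 2 ^ r)))"
      "y < dim_col (mat_diag N (\<lambda>x. block_weight (x div 2 ^ r)))"
    then have xy: "x < N" "y < N" by (auto simp: mat_diag_def)
    then have "mat_sum N (\<lambda>i. block_weight i \<cdot>\<^sub>m block_projector N (2 ^ r) i) {..<M} $$ (x, y) =
        (\<Sum>i<M. (block_weight i \<cdot>\<^sub>m block_projector N (2 ^ r) i) $$ (x, y))"
      by (rule index_mat_sum)
    also have "\<dots> = (\<Sum>i<M. if i = y div 2 ^ r then (if x = y then block_weight (y div 2 ^ r) else 0) else 0)"
      using xy by (intro sum.cong refl) (auto simp: block_projector_def mat_diag_def)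
    finally show "mat_sum N (\<lambda>i. block_weight i \<cdot>\<^sub>m block_projector N (2 ^ r) i) {..<M} $$ (x, y) =
        mat_diag N (\<lambda>x. block_weight (x div 2 ^ r)) $$ (x, y)"
      using xy div_less_M[OF xy(2)] by (simp add: mat_diag_def)
  qed (auto simp: mat_diag_def)
  finally show ?thesis .
qed

text \<open>With \<open>Z = Ugl * V\<close> absorbed into the observable \<open>A\<close>, the sum
  over the group reaches the entries of the conjugated state directly. There the twirl replaces each
  block by its trace over \<open>2 ^ r\<close>, which is the block weight of the coarse-grained
  state.\<close>

lemma twirled_energy:
  "(\<Sum>U\<in>pauli_group r. mat_trace (H * rotated_state N M P V Ugl \<rho> U)) =
    of_nat (card (pauli_group r)) * mat_trace (H * Ugl * coarse * mat_adjoint Ugl)"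
proof -
  define Z where "Z = Ugl * V"
  define A where "A = mat_adjoint Z * H * Z"
  define K where "K U = kron (1\<^sub>m M) U" for U :: "complex mat"
  define g :: complex where "g = of_nat (card (pauli_group r))"
  note V' = unitary_opD[OF unitary_V] and Ugl' = unitary_opD[OF unitary_Ugl]
  note car = mult_carrier_mat[of _ N N _ N]
  have Z: "Z \<in> carrier_mat N N" "mat_adjoint Z \<in> carrier_mat N N"
    using V' Ugl' by (auto simp: Z_def car)
  have A: "A \<in> carrier_mat N N"
    using Z H_carrier by (auto simp: A_def car)
  have K: "K U \<in> carrier_mat N N" "mat_adjoint (K U) \<in> carrier_mat N N" if "U \<in> pauli_group r" for U
    using pauli_group_carrier[OF that] by (auto simp: K_def N_eq)
  have Z_adj: "mat_adjoint Z = mat_adjoint V * mat_adjoint Ugl"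
    unfolding Z_def using V' Ugl' by (simp add: mat_adjoint_mult[of _ N N _ N])
  have rot: "rotated_state N M P V Ugl \<rho> U = Z * (K U * tensor_measured * mat_adjoint (K U)) * mat_adjoint Z"
    if "U \<in> pauli_group r" for U
    using V' Ugl' K[OF that] measured_carrier unfolding Z_adj
    by (simp add: rotated_state_def Let_def Z_def car assoc_mult_mat[of _ N N _ N _ N]
      mat_adjoint_mult[of _ N N _ N] flip: K_def)
  have coarse_rot: "H * Ugl * coarse * mat_adjoint Ugl =
      H * (Z * mat_diag N (\<lambda>x. block_weight (x div 2 ^ r)) * mat_adjoint Z)"
    using V' Ugl' H_carrier unfolding coarse_eq Z_adj
    by (simp add: Z_def car assoc_mult_mat[of _ N N _ N _ N])
  have KBK: "K U * tensor_measured * mat_adjoint (K U) \<in> carrier_mat N N" if "U \<in> pauli_group r" for U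
    using K[OF that] tensor_measured_carrier by (auto simp: car)
  have twirl: "(\<Sum>U\<in>pauli_group r. (K U * tensor_measured * mat_adjoint (K U)) $$ (x, y)) =
      g * mat_diag N (\<lambda>x. block_weight (x div 2 ^ r)) $$ (x, y)" if xy: "x < N" "y < N" for x y
  proof -
    have blk: "x div 2 ^ r * 2 ^ r + c < N" if "c < 2 ^ r" for c
    proof -
      have "x div 2 ^ r * 2 ^ r + c < (x div 2 ^ r + 1) * 2 ^ r" using that by simp
      also have "\<dots> \<le> M * 2 ^ r"
        using div_less_M[OF xy(1)] by (intro mult_right_mono) auto
      finally show ?thesis by (simp add: N_eq)
    qed
    have "(\<Sum>U\<in>pauli_group r. (K U * tensor_measured * mat_adjoint (K U)) $$ (x, y)) =
        (if x = y then g / 2 ^ r * (\<Sum>c<2 ^ r. tensor_measured $$ (x div 2 ^ r * 2 ^ r + c, x div 2 ^ r * 2 ^ r + c)) else 0)"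
      unfolding K_def g_def
      by (rule pauli_twirl) (use tensor_measured_carrier xy index_tensor_measured in \<open>auto simp: N_eq\<close>)
    also have "(\<Sum>c<2 ^ r. tensor_measured $$ (x div 2 ^ r * 2 ^ r + c, x div 2 ^ r * 2 ^ r + c)) =
        (\<Sum>c<2 ^ r. tensor_state $$ (x div 2 ^ r * 2 ^ r + c, x div 2 ^ r * 2 ^ r + c))"
      using blk by (intro sum.cong refl) (simp add: index_tensor_measured)
    also have "\<dots> = complex_of_real (outcome_prob P \<rho> (x div 2 ^ r))"
      using outcome_prob_eq[OF div_less_M[OF xy(1)]] by simp
    finally show ?thesis
      using xy by (simp add: mat_diag_def)
  qed
  have "(\<Sum>U\<in>pauli_group r. mat_trace (H * rotated_state N M P V Ugl \<rho> U)) =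
      (\<Sum>U\<in>pauli_group r. mat_trace (A * (K U * tensor_measured * mat_adjoint (K U))))"
    unfolding A_def
    by (intro sum.cong refl)
       (simp only: rot, rule mat_trace_mult_conj[OF H_carrier Z(1) KBK Z(2)])
  also have "\<dots> = (\<Sum>U\<in>pauli_group r. \<Sum>x<N. \<Sum>y<N. A $$ (x, y) * (K U * tensor_measured * mat_adjoint (K U)) $$ (y, x))"
    using A KBK by (intro sum.cong refl mat_trace_mult) auto
  also have "\<dots> = (\<Sum>x<N. \<Sum>y<N. A $$ (x, y) *
      (\<Sum>U\<in>pauli_group r. (K U * tensor_measured * mat_adjoint (K U)) $$ (y, x)))"
    unfolding sum_distrib_left by (subst sum.swap, intro sum.cong refl, rule sum.swap)
  also have "\<dots> = (\<Sum>x<N. \<Sum>y<N. A $$ (x, y) *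
      (g * mat_diag N (\<lambda>x. block_weight (x div 2 ^ r)) $$ (y, x)))"
    by (intro sum.cong refl) (simp only: twirl lessThan_iff)
  also have "\<dots> = g * mat_trace (A * mat_diag N (\<lambda>x. block_weight (x div 2 ^ r)))"
    by (subst mat_trace_mult[OF A mat_diag_dim]) (simp add: sum_distrib_left mult_ac)
  also have "mat_trace (A * mat_diag N (\<lambda>x. block_weight (x div 2 ^ r))) =
      mat_trace (H * Ugl * coarse * mat_adjoint Ugl)"
    unfolding coarse_rot A_def
    by (rule mat_trace_mult_conj[OF H_carrier Z(1) mat_diag_dim Z(2), symmetric])
  finally show ?thesis by (simp add: g_def)
qed

text \<open>On the range of \<open>P j\<close> that projector acts as the identity and the others as
  zero. The adapted basis therefore diagonalises the coarse-grained state.\<close>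

lemma coarse_eigenvector:
  assumes j: "j < M" and e: "e \<in> op_range (P j)"
  shows "coarse *\<^sub>v e = block_weight j \<cdot>\<^sub>v e"
proof -
  obtain x where x: "x \<in> carrier_vec N" and ex: "e = P j *\<^sub>v x"
    using e P_props(1)[OF j] by (auto simp: op_range_def)
  have ec: "e \<in> carrier_vec N" using ex x P_props(1)[OF j] by simp
  have Pe: "P i *\<^sub>v e = (if i = j then e else 0\<^sub>v N)" if i: "i < M" for i
  proof -
    have "P i *\<^sub>v e = (P i * P j) *\<^sub>v x"
      unfolding ex using P_props(1)[OF i] P_props(1)[OF j] x
      by (rule assoc_mult_mat_vec[symmetric])
    then show ?thesis
      using P_props(3)[OF j] P_orth[OF i j] x by (auto simp: ex)
  qed
  show ?thesis
  proof (rule eq_vecI)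
    fix a assume "a < dim_vec (block_weight j \<cdot>\<^sub>v e)"
    then have a: "a < N" using ec by simp
    have "vec_index (coarse *\<^sub>v e) a = (\<Sum>i<M. vec_index ((block_weight i \<cdot>\<^sub>m P i) *\<^sub>v e) a)"
      unfolding coarse_grained_def using P_props(1) ec a by (intro mat_sum_mult_vec) auto
    also have "\<dots> = (\<Sum>i<M. if i = j then block_weight j * vec_index e a else 0)"
    proof (intro sum.cong refl)
      fix i assume "i \<in> {..<M}"
      then have i: "i < M" by simp
      show "vec_index ((block_weight i \<cdot>\<^sub>m P i) *\<^sub>v e) a = (if i = j then block_weight j * vec_index e a else 0)"
        unfolding smult_mat_mult_vec[OF P_props(1)[OF i] ec] Pe[OF i]
        using a ec by simp
    qed
    finally show "vec_index (coarse *\<^sub>v e) a = vec_index (block_weight j \<cdot>\<^sub>v e) a"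
      using j a ec by simp
  qed (use ec coarse_carrier in auto)
qed

lemma global_unitary_eigenbases:
  obtains b e f and E :: "nat \<Rightarrow> real" where
    "bij_betw b {..<M} {..<M}"
      "\<forall>k<M. \<forall>l<M. k \<le> l \<longrightarrow> outcome_prob P \<rho> (b l) \<le> outcome_prob P \<rho> (b k)"
    and "orthonormal_basis N e" "\<forall>k<N. e k \<in> op_range (P (b (k div 2 ^ r)))"
    and "orthonormal_basis N f" "\<forall>k<N. H *\<^sub>v f k = complex_of_real (E k) \<cdot>\<^sub>v f k"
    and "\<forall>k<N. \<forall>l<N. k \<le> l \<longrightarrow> E k \<le> E l"
    and "\<forall>k<N. Ugl *\<^sub>v e k = f k"
  using Ugl unfolding global_unitary_def by (elim conjE exE) (rule that)

text \<open>Along the adapted basis the eigenvalues are constant on blocks, and \<open>b\<close>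
  lists the blocks by decreasing probability. Since \<open>k div 2 ^ r\<close> is monotone in
  \<open>k\<close>, the whole list is sorted and \<open>Ugl\<close> attains the minimum.\<close>

lemma erg_obs_eq:
  "erg_obs N M r H P \<rho> = Re (mat_trace (H * \<rho>)) - Re (mat_trace (H * Ugl * coarse * mat_adjoint Ugl))"
proof -
  obtain b e f and E :: "nat \<Rightarrow> real" where
    b: "bij_betw b {..<M} {..<M}"
      "\<forall>k<M. \<forall>l<M. k \<le> l \<longrightarrow> outcome_prob P \<rho> (b l) \<le> outcome_prob P \<rho> (b k)"
    and e: "orthonormal_basis N e" "\<forall>k<N. e k \<in> op_range (P (b (k div 2 ^ r)))"
    and f: "orthonormal_basis N f" "\<forall>k<N. H *\<^sub>v f k = complex_of_real (E k) \<cdot>\<^sub>v f k"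
    and E: "\<forall>k<N. \<forall>l<N. k \<le> l \<longrightarrow> E k \<le> E l"
    and U: "\<forall>k<N. Ugl *\<^sub>v e k = f k"
    by (rule global_unitary_eigenbases)
  have bM: "b k < M" if "k < M" for k
    using b(1) that by (auto simp: bij_betw_def)
  have "(LEAST x. \<exists>U. unitary_op N U \<and> x = Re (mat_trace (H * U * coarse * mat_adjoint U))) =
      Re (mat_trace (H * Ugl * coarse * mat_adjoint Ugl))"
  proof (rule Least_energy_eq[OF H_carrier f(1) _ coarse_carrier e(1)])
    fix k assume k: "k < N"
    then show "H *\<^sub>v f k = complex_of_real (E k) \<cdot>\<^sub>v f k" "Ugl *\<^sub>v e k = f k"
      using f(2) U by simp_all
    show "coarse *\<^sub>v e k = complex_of_real (outcome_prob P \<rho> (b (k div 2 ^ r)) / 2 ^ r) \<cdot>\<^sub>v e k"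
      using e(2) k by (intro coarse_eigenvector bM div_less_M) auto
  next
    fix k l assume kl: "k \<le> l" "l < N"
    then show "E k \<le> E l" using E by simp
    have "k div 2 ^ r \<le> l div 2 ^ r" using kl by (simp add: div_le_mono)
    then show "outcome_prob P \<rho> (b (l div 2 ^ r)) / 2 ^ r \<le> outcome_prob P \<rho> (b (k div 2 ^ r)) / 2 ^ r"
      using kl div_less_M[of k] div_less_M[of l] b(2) by (intro divide_right_mono) auto
  qed (rule unitary_Ugl)
  then show ?thesis by (simp add: erg_obs_def)
qed

text \<open>The fair coin gives half the energy of \<open>\<rho>\<close> minus half the mean rotated
  energy; the factor 2 in the protocol output undoes this halving.\<close>

lemma protocol_iteration_props:
  defines "p \<equiv> protocol_iteration N M r H P V Ugl \<rho>"
  shows "set_pmf p \<subseteq> {- spectral_norm H..spectral_norm H}"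
    and "2 * measure_pmf.expectation p (\<lambda>x. x) = erg_obs N M r H P \<rho>"
proof -
  obtain f and E :: "nat \<Rightarrow> real" where
    f: "orthonormal_basis N f" and Hf: "\<forall>k<N. H *\<^sub>v f k = complex_of_real (E k) \<cdot>\<^sub>v f k"
    by (rule global_unitary_eigenbases)
  have fE: "H *\<^sub>v f k = complex_of_real (E k) \<cdot>\<^sub>v f k" if "k < N" for k
    using Hf that by blast
  have mH: "- H \<in> carrier_mat N N" using H_carrier by simp
  \<comment> \<open>The energy eigenbasis also diagonalises \<open>- H\<close>, with negated values;
    a symmetric interval thus contains the outcomes of both branches.\<close>
  have fm: "- H *\<^sub>v f k = complex_of_real (- E k) \<cdot>\<^sub>v f k" if "k < N" for k
  proof -
    have fc: "f k \<in> carrier_vec N" using f that by (auto simp: orthonormal_basis_def)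
    have "- H *\<^sub>v f k = - (H *\<^sub>v f k)"
      using H_carrier fc by (intro eq_vecI) auto
    then show ?thesis using fE[OF that] by (auto intro!: eq_vecI)
  qed
  have E: "E k \<in> {- spectral_norm H..spectral_norm H}" if "k < N" for k
    using abs_eigenbasis_value_le_spectral_norm[OF H_carrier f fE that] by auto
  define q1 where "q1 = measure_observable H \<rho>"
  define q2 where "q2 = (\<lambda>U. measure_observable (- H) (rotated_state N M P V Ugl \<rho> U))"
  define q where "q = bind_pmf (pmf_of_set (pauli_group r)) q2"
  have q1: "set_pmf q1 \<subseteq> E ` {..<N}" "measure_pmf.expectation q1 (\<lambda>x. x) = Re (mat_trace (H * \<rho>))"
    unfolding q1_def using measure_observable_diagonal[OF H_carrier f fE \<rho>_carrier \<rho>_psd] \<rho>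
    by (auto simp: density_op_def)
  have q2: "set_pmf (q2 U) \<subseteq> (\<lambda>k. - E k) ` {..<N}"
      "measure_pmf.expectation (q2 U) (\<lambda>x. x) = - Re (mat_trace (H * rotated_state N M P V Ugl \<rho> U))"
    if "U \<in> pauli_group r" for U
  proof -
    note \<sigma> = rotated_state_density[OF that]
    show "set_pmf (q2 U) \<subseteq> (\<lambda>k. - E k) ` {..<N}"
      unfolding q2_def by (rule measure_observable_diagonal(1)[OF mH f fm \<sigma>])
    have "mat_trace (- H * rotated_state N M P V Ugl \<rho> U) = - mat_trace (H * rotated_state N M P V Ugl \<rho> U)"
      using H_carrier \<sigma>(1) by (simp add: mat_trace_def sum_negf)
    then show "measure_pmf.expectation (q2 U) (\<lambda>x. x) = - Re (mat_trace (H * rotated_state N M P V Ugl \<rho> U))"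
      unfolding q2_def using measure_observable_diagonal(2)[OF mH f fm \<sigma>] by simp
  qed
  have q: "set_pmf q \<subseteq> (\<lambda>k. - E k) ` {..<N}"
    unfolding q_def using q2(1) finite_pauli_group pauli_group_nonempty by fastforce
  have p: "p = bind_pmf (bernoulli_pmf (1 / 2)) (\<lambda>c. if c then q1 else q)"
    unfolding p_def protocol_iteration_def q_def q1_def q2_def ..
  have set_p: "set_pmf p \<subseteq> set_pmf q1 \<union> set_pmf q"
    by (auto simp: p split: if_splits)
  show "set_pmf p \<subseteq> {- spectral_norm H..spectral_norm H}"
  proof
    fix x assume "x \<in> set_pmf p"
    then have "x \<in> E ` {..<N} \<union> (\<lambda>k. - E k) ` {..<N}"
      using set_p q1(1) q by blast
    then obtain k where "k < N" "x = E k \<or> x = - E k"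
      by auto
    then show "x \<in> {- spectral_norm H..spectral_norm H}"
      using E[of k] by auto
  qed
  define G where "G = real (card (pauli_group r))"
  have G: "0 < G"
    using finite_pauli_group pauli_group_nonempty by (simp add: G_def card_gt_0_iff)
  \<comment> \<open>Each measurement has finitely many outcomes, so the expectation of the mixture
    is the average of the expectations.\<close>
  have "measure_pmf.expectation q (\<lambda>x. x) =
      (\<Sum>U\<in>pauli_group r. measure_pmf.expectation (q2 U) (\<lambda>x. x) /\<^sub>R G)"
    unfolding q_def G_def using q2(1)
    by (intro pmf_expectation_bind_pmf_of_set pauli_group_nonempty finite_pauli_group)
       (rule finite_subset[OF q2(1)], simp_all)
  also have "\<dots> = (\<Sum>U\<in>pauli_group r. - Re (mat_trace (H * rotated_state N M P V Ugl \<rho> U))) / G"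
    unfolding sum_divide_distrib using q2(2) by (intro sum.cong) (auto simp: divide_inverse mult.commute)
  also have "\<dots> = - Re (\<Sum>U\<in>pauli_group r. mat_trace (H * rotated_state N M P V Ugl \<rho> U)) / G"
    by (simp add: sum_negf)
  also have "\<dots> = - Re (mat_trace (H * Ugl * coarse * mat_adjoint Ugl))"
    using G by (simp add: twirled_energy G_def)
  finally have q_exp: "measure_pmf.expectation q (\<lambda>x. x) = - Re (mat_trace (H * Ugl * coarse * mat_adjoint Ugl))" .
  have "measure_pmf.expectation p (\<lambda>x. x) =
      (\<Sum>c\<in>UNIV. pmf (bernoulli_pmf (1 / 2)) c *\<^sub>R
        measure_pmf.expectation (if c then q1 else q) (\<lambda>x. x))"
    unfolding p by (rule pmf_expectation_bind) (use q1(1) q in \<open>auto intro: finite_subset\<close>)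
  also have "\<dots> = (Re (mat_trace (H * \<rho>)) - Re (mat_trace (H * Ugl * coarse * mat_adjoint Ugl))) / 2"
    by (simp add: UNIV_bool q1(2) q_exp)
  finally show "2 * measure_pmf.expectation p (\<lambda>x. x) = erg_obs N M r H P \<rho>"
    by (simp add: erg_obs_eq)
qed

text \<open>Hoeffding's inequality is applied with the half-width \<open>h\<close> at which the failure probability is
  exactly \<open>\<delta>\<close>, rather than with \<open>\<parallel>H\<parallel>\<close>; this covers \<open>H = 0\<close> as well.\<close>

lemma protocol_output_accuracy:
  assumes eps: "0 < \<epsilon>" and \<delta>: "0 < \<delta>" "\<delta> < 1" and T: "1 \<le> T"
    and T_ge: "real T \<ge> 8 * ((spectral_norm H)\<^sup>2 * ln (2 / \<delta>) / \<epsilon>\<^sup>2)"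
  shows "measure_pmf.prob (protocol_output N M r H P V Ugl \<rho> T)
      {\<mu>. \<bar>\<mu> - erg_obs N M r H P \<rho>\<bar> \<le> \<epsilon>} \<ge> 1 - \<delta>"
proof -
  define L where "L = ln (2 / \<delta>)"
  define h where "h = sqrt (real T * \<epsilon>\<^sup>2 / (8 * L))"
  have L: "0 < L" using \<delta> by (simp add: L_def)
  have h: "0 < h" using L eps T by (simp add: h_def)
  have h2: "h\<^sup>2 = real T * \<epsilon>\<^sup>2 / (8 * L)" using L by (simp add: h_def)
  \<comment> \<open>Solved for the squared norm, the lower bound on \<open>T\<close> is this
    inequality.\<close>
  have "(spectral_norm H)\<^sup>2 \<le> h\<^sup>2"
  proof -
    have "8 * ((spectral_norm H)\<^sup>2 * L / \<epsilon>\<^sup>2) * \<epsilon>\<^sup>2 \<le> real T * \<epsilon>\<^sup>2"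
      unfolding L_def by (intro mult_right_mono T_ge) simp
    also have "8 * ((spectral_norm H)\<^sup>2 * L / \<epsilon>\<^sup>2) * \<epsilon>\<^sup>2 = (spectral_norm H)\<^sup>2 * (8 * L)"
      using eps by simp
    finally show ?thesis
      unfolding h2 using L by (subst pos_le_divide_eq) auto
  qed
  then have "spectral_norm H \<le> h" by (rule power2_le_imp_le) (use h in simp)
  then have "set_pmf (protocol_iteration N M r H P V Ugl \<rho>) \<subseteq> {- h..h}"
    using protocol_iteration_props(1) by fastforce
  from Hoeffding_scaled_mean[OF h this T eps]
  have "measure_pmf.prob (protocol_output N M r H P V Ugl \<rho> T)
      {\<mu>. \<bar>\<mu> - erg_obs N M r H P \<rho>\<bar> \<le> \<epsilon>} \<ge> 1 - 2 * exp (- (real T * \<epsilon>\<^sup>2 / (8 * h\<^sup>2)))"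
    by (simp only: protocol_output_def protocol_iteration_props(2))
  also have "real T * \<epsilon>\<^sup>2 / (8 * h\<^sup>2) = L"
    unfolding h2 using L eps T by (simp add: field_simps)
  also have "2 * exp (- L) = \<delta>"
    using \<delta> by (simp add: L_def exp_minus)
  finally show ?thesis .
qed

end

theorem mainTheorem2:
  shows "\<exists>C>0. \<forall>(n :: nat) (r :: nat) (N :: nat) (M :: nat) (H :: complex mat) (P :: nat \<Rightarrow> complex mat)
      (\<rho> :: complex mat) (V :: complex mat) (Ugl :: complex mat) (\<epsilon> :: real) (\<delta> :: real) (T :: nat).
    r \<le> n \<longrightarrow> N = 2 ^ n \<longrightarrow> M = 2 ^ (n - r) \<longrightarrow>
    hermitian_op N H \<longrightarrow>
    projective_measurement N M r P \<longrightarrow>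
    density_op N \<rho> \<longrightarrow>
    tensor_identification N M r P V \<longrightarrow>
    global_unitary N M r H P \<rho> Ugl \<longrightarrow>
    0 < \<epsilon> \<longrightarrow> 0 < \<delta> \<longrightarrow> \<delta> < 1 \<longrightarrow>
    1 \<le> T \<longrightarrow> real T \<ge> C * ((spectral_norm H)\<^sup>2 * ln (2 / \<delta>) / \<epsilon>\<^sup>2) \<longrightarrow>
    measure_pmf.prob (protocol_output N M r H P V Ugl \<rho> T)
      {\<mu>. \<bar>\<mu> - erg_obs N M r H P \<rho>\<bar> \<le> \<epsilon>} \<ge> 1 - \<delta>"
  by (rule exI[of _ 8]) (auto intro: protocol_output_accuracy)

end
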